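(* Assume the exponential-time hypothesis (ETH). Then there is no algorithm and no function $f$ such that the algorithm, given $q\in\mathbb{N}$, a first-order formula $\phi(\bar{x};\bar{y})$ of quantifier rank at most $q$, a finite relational background structure $\mathcal{B}$ (with no restriction on its degree) and a training sequence $T$ for which some parameter tuple making the hypothesis consistent exists, returns a tuple $\bar{v}$ such that $[\![\phi(\bar{x};\bar{v})]\!]^{\mathcal{B}}$ is consistent with all training examples in $T$, and runs in time $f(q)\cdot|\mathcal{B}|^{o(q)}$.
   Context: ETH: there is $\varepsilon>0$ such that 3-SAT cannot be solved in time $2^{\varepsilon n}$ on instances with $n$ variables. A training sequence is $T=((\bar{u}_1,c_1),\dots,(\bar{u}_t,c_t))$ with $\bar{u}_i\in U(\mathcal{B})^k$ and $c_i\in\{0,1\}$. For a first-order formula $\phi(\bar{x};\bar{y})$ ($\bar{x}$ a $k$-tuple and $\bar{y}$ an $\ell$-tuple of variables) and $\bar{v}\in U(\mathcal{B})^\ell$, $[\![\phi(\bar{x};\bar{v})]\!]^{\mathcal{B}}:U(\mathcal{B})^k\to\{0,1\}$ maps $\bar{u}$ to $1$ iff $\mathcal{B}\models\phi(\bar{u};\bar{v})$; it is consistent with $T$ if it maps each $\bar{u}_i$ to $c_i$. $|\mathcal{B}|$ is the size of the universe of $\mathcal{B}$. *)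

theory Defs
  imports Complex_Main "HOL-Library.Landau_Symbols"
begin

section \<open>Model of computation\<close>

text \<open>
  Algorithms are programs of the WHILE language over binary trees (N. D. Jones,
  Computability and Complexity from a Programming Perspective, MIT Press 1997).  Every basic
  command costs one time unit.  There is no equality test on trees, so with shared
  representations each command is a constant number of pointer operations, and the running time is
  polynomially related to that of Turing machines, in both directions.
\<close>

datatype tree = Leaf | Branch tree tree

fun tree_size :: "tree \<Rightarrow> nat" where
  "tree_size Leaf = 1"
| "tree_size (Branch l r) = Suc (tree_size l + tree_size r)"

fun left :: "tree \<Rightarrow> tree" where
  "left Leaf = Leaf"
| "left (Branch l r) = l"

fun right :: "tree \<Rightarrow> tree" where
  "right Leaf = Leaf"
| "right (Branch l r) = r"

type_synonym store = "nat \<Rightarrow> tree"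

datatype expr = ELeaf | EVar nat | EBranch nat nat | ELeft nat | ERight nat

fun expr_val :: "expr \<Rightarrow> store \<Rightarrow> tree" where
  "expr_val ELeaf s = Leaf"
| "expr_val (EVar x) s = s x"
| "expr_val (EBranch x y) s = Branch (s x) (s y)"
| "expr_val (ELeft x) s = left (s x)"
| "expr_val (ERight x) s = right (s x)"

datatype com =
    Assign nat expr
  | Seq com com
  | If nat com com
  | While nat com

text \<open>\<open>exec p s t s'\<close>: started in store \<open>s\<close>, the program \<open>p\<close> halts after exactly \<open>t\<close> steps in
  store \<open>s'\<close>.  Tests check whether a variable holds a tree other than \<open>Leaf\<close>.\<close>

inductive exec :: "com \<Rightarrow> store \<Rightarrow> nat \<Rightarrow> store \<Rightarrow> bool" where
  Assign: "exec (Assign x e) s 1 (s(x := expr_val e s))"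
| Seq: "exec p s t s' \<Longrightarrow> exec p' s' t' s'' \<Longrightarrow> exec (Seq p p') s (t + t') s''"
| IfTrue: "s x \<noteq> Leaf \<Longrightarrow> exec p s t s' \<Longrightarrow> exec (If x p p') s (Suc t) s'"
| IfFalse: "s x = Leaf \<Longrightarrow> exec p' s t s' \<Longrightarrow> exec (If x p p') s (Suc t) s'"
| WhileFalse: "s x = Leaf \<Longrightarrow> exec (While x p) s 1 s"
| WhileTrue: "s x \<noteq> Leaf \<Longrightarrow> exec p s t s' \<Longrightarrow> exec (While x p) s' t' s'' \<Longrightarrow>
    exec (While x p) s (Suc (t + t')) s''"

definition outputs_in :: "com \<Rightarrow> tree \<Rightarrow> nat \<Rightarrow> tree \<Rightarrow> bool" where
  "outputs_in p inp t out \<longleftrightarrow> (\<exists>s'. exec p ((\<lambda>_. Leaf)(0 := inp)) t s' \<and> s' 0 = out)"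


section \<open>Encodings\<close>

text \<open>Natural numbers are written in unary.  Below they are names of variables and relation
  symbols, arities, elements of a universe that has to be listed anyway, or the number of variables
  of a CNF, so up to renaming of symbols this changes the size of an input only polynomially.\<close>

fun enc_nat :: "nat \<Rightarrow> tree" where
  "enc_nat 0 = Leaf"
| "enc_nat (Suc n) = Branch Leaf (enc_nat n)"

fun enc_bool :: "bool \<Rightarrow> tree" where
  "enc_bool False = Leaf"
| "enc_bool True = Branch Leaf Leaf"

fun enc_list :: "('a \<Rightarrow> tree) \<Rightarrow> 'a list \<Rightarrow> tree" where
  "enc_list e [] = Leaf"
| "enc_list e (x # xs) = Branch (e x) (enc_list e xs)"

fun enc_pair :: "('a \<Rightarrow> tree) \<Rightarrow> ('b \<Rightarrow> tree) \<Rightarrow> 'a \<times> 'b \<Rightarrow> tree" where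
  "enc_pair e e' (x, y) = Branch (e x) (e' y)"


section \<open>3-SAT and the exponential-time hypothesis\<close>

text \<open>A literal is a variable with its sign, \<open>True\<close> meaning positive.  The literals of a clause
  may coincide, so clauses have between one and three literals.\<close>

type_synonym literal = "nat \<times> bool"
type_synonym clause = "literal \<times> literal \<times> literal"

fun clause_lits :: "clause \<Rightarrow> literal set" where
  "clause_lits (a, b, c) = {a, b, c}"

text \<open>A 3-CNF on the variables \<open>0, \<dots>, n - 1\<close>.  Clauses are not repeated, so that the size of an
  instance is polynomial in \<open>n\<close>.\<close>

definition is_3cnf :: "nat \<Rightarrow> clause list \<Rightarrow> bool" where
  "is_3cnf n F \<longleftrightarrow> distinct F \<and> (\<forall>C \<in> set F. \<forall>l \<in> clause_lits C. fst l < n)"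

definition satisfiable :: "clause list \<Rightarrow> bool" where
  "satisfiable F \<longleftrightarrow>
     (\<exists>\<alpha> :: nat \<Rightarrow> bool. \<forall>C \<in> set F. \<exists>l \<in> clause_lits C. \<alpha> (fst l) = snd l)"

definition enc_3cnf :: "nat \<Rightarrow> clause list \<Rightarrow> tree" where
  "enc_3cnf n F =
     (let enc_lit = enc_pair enc_nat enc_bool
      in Branch (enc_nat n) (enc_list (enc_pair enc_lit (enc_pair enc_lit enc_lit)) F))"

text \<open>The multiplicative constant is needed: a bound of \<open>2 powr (\<epsilon> * n)\<close> for all \<open>n\<close> would
  leave no time for reading the input when \<open>n\<close> is small.\<close>

definition solves_3sat_in_exp :: "com \<Rightarrow> real \<Rightarrow> bool" where
  "solves_3sat_in_exp p \<epsilon> \<longleftrightarrow>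
     (\<exists>K :: real. \<forall>n F. is_3cnf n F \<longrightarrow>
        (\<exists>t. outputs_in p (enc_3cnf n F) t (enc_bool (satisfiable F)) \<and>
             real t \<le> K * 2 powr (\<epsilon> * real n)))"

definition ETH :: bool where
  "ETH \<longleftrightarrow> (\<exists>\<epsilon> > 0. \<not> (\<exists>p. solves_3sat_in_exp p \<epsilon>))"


section \<open>First-order logic over relational structures\<close>

datatype fo =
    Eq nat nat
  | Rel nat "nat list"
  | Neg fo
  | Conj fo fo
  | Disj fo fo
  | Ex nat fo
  | All nat fo

fun qrank :: "fo \<Rightarrow> nat" where
  "qrank (Eq x y) = 0"
| "qrank (Rel r zs) = 0"
| "qrank (Neg \<phi>) = qrank \<phi>"
| "qrank (Conj \<phi> \<psi>) = max (qrank \<phi>) (qrank \<psi>)"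
| "qrank (Disj \<phi> \<psi>) = max (qrank \<phi>) (qrank \<psi>)"
| "qrank (Ex x \<phi>) = Suc (qrank \<phi>)"
| "qrank (All x \<phi>) = Suc (qrank \<phi>)"

fun free_vars :: "fo \<Rightarrow> nat set" where
  "free_vars (Eq x y) = {x, y}"
| "free_vars (Rel r zs) = set zs"
| "free_vars (Neg \<phi>) = free_vars \<phi>"
| "free_vars (Conj \<phi> \<psi>) = free_vars \<phi> \<union> free_vars \<psi>"
| "free_vars (Disj \<phi> \<psi>) = free_vars \<phi> \<union> free_vars \<psi>"
| "free_vars (Ex x \<phi>) = free_vars \<phi> - {x}"
| "free_vars (All x \<phi>) = free_vars \<phi> - {x}"

text \<open>A finite relational vocabulary is the list of the arities of its symbols
  \<open>0, 1, \<dots>\<close>.\<close>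

fun wf_fo :: "nat list \<Rightarrow> fo \<Rightarrow> bool" where
  "wf_fo \<tau> (Eq x y) \<longleftrightarrow> True"
| "wf_fo \<tau> (Rel r zs) \<longleftrightarrow> r < length \<tau> \<and> length zs = \<tau> ! r"
| "wf_fo \<tau> (Neg \<phi>) \<longleftrightarrow> wf_fo \<tau> \<phi>"
| "wf_fo \<tau> (Conj \<phi> \<psi>) \<longleftrightarrow> wf_fo \<tau> \<phi> \<and> wf_fo \<tau> \<psi>"
| "wf_fo \<tau> (Disj \<phi> \<psi>) \<longleftrightarrow> wf_fo \<tau> \<phi> \<and> wf_fo \<tau> \<psi>"
| "wf_fo \<tau> (Ex x \<phi>) \<longleftrightarrow> wf_fo \<tau> \<phi>"
| "wf_fo \<tau> (All x \<phi>) \<longleftrightarrow> wf_fo \<tau> \<phi>"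

record 'a rel_structure =
  universe :: "'a set"
  interp :: "nat \<Rightarrow> 'a list set"

fun sat :: "'a rel_structure \<Rightarrow> (nat \<Rightarrow> 'a) \<Rightarrow> fo \<Rightarrow> bool" where
  "sat B \<sigma> (Eq x y) \<longleftrightarrow> \<sigma> x = \<sigma> y"
| "sat B \<sigma> (Rel r zs) \<longleftrightarrow> map \<sigma> zs \<in> interp B r"
| "sat B \<sigma> (Neg \<phi>) \<longleftrightarrow> \<not> sat B \<sigma> \<phi>"
| "sat B \<sigma> (Conj \<phi> \<psi>) \<longleftrightarrow> sat B \<sigma> \<phi> \<and> sat B \<sigma> \<psi>"
| "sat B \<sigma> (Disj \<phi> \<psi>) \<longleftrightarrow> sat B \<sigma> \<phi> \<or> sat B \<sigma> \<psi>"
| "sat B \<sigma> (Ex x \<phi>) \<longleftrightarrow> (\<exists>a \<in> universe B. sat B (\<sigma>(x := a)) \<phi>)"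
| "sat B \<sigma> (All x \<phi>) \<longleftrightarrow> (\<forall>a \<in> universe B. sat B (\<sigma>(x := a)) \<phi>)"

definition tuples :: "'a rel_structure \<Rightarrow> nat \<Rightarrow> 'a list set" where
  "tuples B k = {us. length us = k \<and> set us \<subseteq> universe B}"

text \<open>\<open>hypothesis B \<phi> xs ys vs us\<close> is the value at \<open>us\<close> of the hypothesis given by the formula
  \<open>\<phi>(xs; ys)\<close> and the parameters \<open>vs\<close> for \<open>ys\<close>; labels are Booleans, with \<open>True\<close> for 1.\<close>

definition hypothesis ::
  "'a rel_structure \<Rightarrow> fo \<Rightarrow> nat list \<Rightarrow> nat list \<Rightarrow> 'a list \<Rightarrow> 'a list \<Rightarrow> bool" where
  "hypothesis B \<phi> xs ys vs us \<longleftrightarrow>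
     sat B (\<lambda>z. the (map_of (zip (xs @ ys) (us @ vs)) z)) \<phi>"

definition consistent :: "('a list \<Rightarrow> bool) \<Rightarrow> ('a list \<times> bool) list \<Rightarrow> bool" where
  "consistent H T \<longleftrightarrow> (\<forall>(u, c) \<in> set T. H u = c)"


section \<open>The learning problem\<close>

text \<open>As input of an algorithm, a finite structure has the universe \<open>{..<N}\<close> and is given by \<open>N\<close>
  and one table per relation symbol, listing the tuples of the relation in any order.\<close>

record learning_instance =
  rank :: nat
  formula :: fo
  xvars :: "nat list"
  yvars :: "nat list"
  vocab :: "nat list"
  usize :: nat
  tables :: "nat list list list"
  training :: "(nat list \<times> bool) list"

definition background :: "learning_instance \<Rightarrow> nat rel_structure" where
  "background I =
     \<lparr>universe = {..<usize I},
      interp = (\<lambda>r. if r < length (tables I) then set (tables I ! r) else {})\<rparr>"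

definition consistent_params :: "learning_instance \<Rightarrow> nat list \<Rightarrow> bool" where
  "consistent_params I v \<longleftrightarrow>
     v \<in> tuples (background I) (length (yvars I)) \<and>
     consistent (hypothesis (background I) (formula I) (xvars I) (yvars I) v) (training I)"

definition learnable_instance :: "learning_instance \<Rightarrow> bool" where
  "learnable_instance I \<longleftrightarrow>
     usize I > 0 \<and>
     length (tables I) = length (vocab I) \<and>
     (\<forall>r < length (vocab I). set (tables I ! r) \<subseteq> tuples (background I) (vocab I ! r)) \<and>
     wf_fo (vocab I) (formula I) \<and>
     qrank (formula I) \<le> rank I \<and>
     distinct (xvars I @ yvars I) \<and>
     free_vars (formula I) \<subseteq> set (xvars I @ yvars I) \<and>
     (\<forall>(u, c) \<in> set (training I). u \<in> tuples (background I) (length (xvars I))) \<and>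
     (\<exists>v. consistent_params I v)"

fun enc_fo :: "fo \<Rightarrow> tree" where
  "enc_fo (Eq x y) = Branch (enc_nat 0) (Branch (enc_nat x) (enc_nat y))"
| "enc_fo (Rel r zs) = Branch (enc_nat 1) (Branch (enc_nat r) (enc_list enc_nat zs))"
| "enc_fo (Neg \<phi>) = Branch (enc_nat 2) (enc_fo \<phi>)"
| "enc_fo (Conj \<phi> \<psi>) = Branch (enc_nat 3) (Branch (enc_fo \<phi>) (enc_fo \<psi>))"
| "enc_fo (Disj \<phi> \<psi>) = Branch (enc_nat 4) (Branch (enc_fo \<phi>) (enc_fo \<psi>))"
| "enc_fo (Ex x \<phi>) = Branch (enc_nat 5) (Branch (enc_nat x) (enc_fo \<phi>))"
| "enc_fo (All x \<phi>) = Branch (enc_nat 6) (Branch (enc_nat x) (enc_fo \<phi>))"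

definition enc_tuple :: "nat list \<Rightarrow> tree" where
  "enc_tuple = enc_list enc_nat"

definition enc_instance :: "learning_instance \<Rightarrow> tree" where
  "enc_instance I = enc_list id
     [enc_nat (rank I),
      enc_fo (formula I),
      enc_list enc_nat (xvars I),
      enc_list enc_nat (yvars I),
      enc_list enc_nat (vocab I),
      enc_nat (usize I),
      enc_list (enc_list enc_tuple) (tables I),
      enc_list (enc_pair enc_tuple enc_bool) (training I)]"

text \<open>
  Time \<open>f q * |B| powr h q\<close>, times a factor polynomial in the length of the input.  Neither the
  formula, nor the training sequence, nor the arities of the relations are bounded in terms of \<open>q\<close>
  and \<open>|B|\<close>; without this factor no algorithm could even read its input in time, and the
  impossibility of learning would hold for that reason alone.  For \<open>d = 0\<close> the bound is
  \<open>f q * |B| powr h q\<close>.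
\<close>

definition learns_in_time ::
  "com \<Rightarrow> (nat \<Rightarrow> real) \<Rightarrow> (nat \<Rightarrow> real) \<Rightarrow> nat \<Rightarrow> bool" where
  "learns_in_time p f h d \<longleftrightarrow>
     (\<forall>I. learnable_instance I \<longrightarrow>
        (\<exists>v t. consistent_params I v \<and>
               outputs_in p (enc_instance I) t (enc_tuple v) \<and>
               real t \<le> f (rank I) * real (card (universe (background I))) powr h (rank I)
                          * real (tree_size (enc_instance I)) ^ d))"

end

theory Submission
  imports Defs
begin

text \<open>
  Given a learner, 3-SAT is solved in time \<open>2 powr (\<epsilon> * n)\<close> for every \<open>\<epsilon> > 0\<close>.  A CNF \<open>F\<close> is turned
  into an instance with the formula \<open>x = y \<longleftrightarrow> \<psi>\<close>, where the sentence \<open>\<psi>\<close> says that \<open>F\<close> is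
  satisfiable, and with the single positive example \<open>x = 0\<close>.  Whether or not \<open>F\<close> is satisfiable, a
  consistent parameter exists, and it is \<open>0\<close> iff \<open>F\<close> is satisfiable; so the learner always halts in
  time, and no clock is needed.

  The sentence \<open>\<psi>\<close> quantifies \<open>q\<close> elements \<open>z\<^sub>1, \<dots>, z\<^sub>q\<close> and then spells out \<open>F\<close>, expressing the
  truth of a variable \<open>v\<close> by \<open>L\<^sub>v z\<^sub>1 \<or> \<dots> \<or> L\<^sub>v z\<^sub>q\<close> for a unary relation \<open>L\<^sub>v\<close>.  An element of the
  structure thus stands for a set of variables, and all that matters is that every set of variables
  is the union of \<open>q\<close> sets in the universe.  The variables are dealt in turn to \<open>q\<close> blocks, and the
  universe consists of the subsets of the blocks, about \<open>q * 2 powr (n / q)\<close> many.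

  One program performs this reduction for all \<open>q\<close>, in time polynomial in the size of the universe;
  hence the exponent of this polynomial does not depend on \<open>q\<close>, and its contribution
  \<open>2 powr (O(n / q))\<close>, like that of \<open>|B| powr o(q)\<close>, is below \<open>2 powr (\<epsilon> * n)\<close> for large \<open>q\<close>.
  As \<open>q\<close> may be fixed in terms of \<open>\<epsilon>\<close>, the factor \<open>f q\<close> is a constant.
\<close>

subsection \<open>Composing programs\<close>

text \<open>Lies strictly above every register that the program reads or writes, so a caller may
  keep its own data in the registers from this number on.\<close>

fun cbound :: "com \<Rightarrow> nat" where
  "cbound (Assign x ELeaf) = Suc x"
| "cbound (Assign x (EVar y)) = Suc (max x y)"
| "cbound (Assign x (EBranch y z)) = Suc (max x (max y z))"
| "cbound (Assign x (ELeft y)) = Suc (max x y)"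
| "cbound (Assign x (ERight y)) = Suc (max x y)"
| "cbound (Seq p p') = max (cbound p) (cbound p')"
| "cbound (If x p p') = max (Suc x) (max (cbound p) (cbound p'))"
| "cbound (While x p) = max (Suc x) (cbound p)"

lemma expr_val_cong:
  assumes "cbound (Assign x e) \<le> M" "\<And>v. v < M \<Longrightarrow> r v = s v"
  shows "expr_val e r = expr_val e s" "x < M"
  using assms by (cases e; auto)+

text \<open>No register from \<open>M\<close> on occurs in the program, so a run depends only on the
  lower ones and can be replayed, step for step, in any store that agrees there.\<close>

lemma exec_frame:
  assumes "exec p s t s'" "cbound p \<le> M" "\<And>v. v < M \<Longrightarrow> r v = s v"
  shows "\<exists>r'. exec p r t r' \<and> (\<forall>v < M. r' v = s' v) \<and> (\<forall>v \<ge> M. r' v = r v)"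
  using assms
proof (induction arbitrary: r rule: exec.induct)
  case (Assign x e s)
  have "expr_val e r = expr_val e s" "x < M"
    using expr_val_cong[OF Assign(1,2)] by auto
  have "exec (Assign x e) r 1 (r(x := expr_val e s))"
    using exec.Assign[of x e r] \<open>expr_val e r = expr_val e s\<close> by simp
  then show ?case
    using Assign(2) \<open>x < M\<close> by (metis fun_upd_apply linorder_not_le)
next
  case (Seq p s t s' p' t' s'')
  obtain r' where r': "exec p r t r'" "\<forall>v < M. r' v = s' v" "\<forall>v \<ge> M. r' v = r v"
    using Seq.IH(1)[of r] Seq.prems by auto
  obtain r'' where "exec p' r' t' r''" "\<forall>v < M. r'' v = s'' v" "\<forall>v \<ge> M. r'' v = r' v"
    using Seq.IH(2)[of r'] Seq.prems r' by auto
  then show ?case using r' exec.Seq by metis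
next
  case (IfTrue s x p t s' p')
  then show ?case using exec.IfTrue[of r x] by simp blast
next
  case (IfFalse s x p' t s' p)
  then show ?case using exec.IfFalse[of r x] by simp blast
next
  case (WhileFalse s x p)
  then show ?case using exec.WhileFalse[of r x p] by auto
next
  case (WhileTrue s x p t s' t' s'')
  obtain r' where r': "exec p r t r'" "\<forall>v < M. r' v = s' v" "\<forall>v \<ge> M. r' v = r v"
    using WhileTrue.IH(1)[of r] WhileTrue.prems by auto
  obtain r'' where "exec (While x p) r' t' r''" "\<forall>v < M. r'' v = s'' v" "\<forall>v \<ge> M. r'' v = r' v"
    using WhileTrue.IH(2)[of r'] WhileTrue.prems r' by auto
  moreover have "r x \<noteq> Leaf" using WhileTrue by simp
  ultimately show ?case using r' exec.WhileTrue by metis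
qed

section \<open>Calling a program as a subroutine\<close>

text \<open>There is no skip command, so the base case clears register 0 as a dummy step. Hence
  \<open>clear n\<close> takes \<open>Suc n\<close> steps, and its effect is described only for
  \<open>0 < n\<close>.\<close>

fun clear :: "nat \<Rightarrow> com" where
  "clear 0 = Assign 0 ELeaf"
| "clear (Suc n) = Seq (clear n) (Assign n ELeaf)"

lemma exec_clear:
  "0 < n \<Longrightarrow> exec (clear n) s (Suc n) (\<lambda>v. if v < n then Leaf else s v)"
proof (induction n)
  case (Suc n)
  show ?case
  proof (cases n)
    case 0
    have "exec (Seq (Assign 0 ELeaf) (Assign 0 ELeaf)) s (1 + 1) (s(0 := Leaf, 0 := Leaf))"
      using exec.Seq[OF exec.Assign[of 0 ELeaf s] exec.Assign[of 0 ELeaf]] by simp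
    moreover have "s(0 := Leaf, 0 := Leaf) = (\<lambda>v. if v < Suc n then Leaf else s v)"
      using 0 by auto
    ultimately show ?thesis using 0 by simp
  next
    case (Suc m)
    define s' where "s' = (\<lambda>v. if v < n then Leaf else s v)"
    have "exec (clear n) s (Suc n) s'" using Suc.IH Suc unfolding s'_def by simp
    moreover have "exec (Assign n ELeaf) s' 1 (s'(n := Leaf))"
      using exec.Assign[of n ELeaf] by simp
    moreover have "s'(n := Leaf) = (\<lambda>v. if v < Suc n then Leaf else s v)"
      by (auto simp: s'_def less_Suc_eq)
    ultimately show ?thesis
      using exec.Seq[of "clear n" s "Suc n" s' "Assign n ELeaf" 1 "s'(n := Leaf)"] by simp
  qed
qed simp

text \<open>\<open>outputs_in\<close> starts from a store that is \<open>Leaf\<close> outside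
  register 0, so the working registers of \<open>p\<close> are wiped before the argument is copied
  from \<open>a\<close>. Both \<open>a\<close> and the result register \<open>r\<close> are meant to
  lie at or above \<open>M\<close>.\<close>

definition call :: "com \<Rightarrow> nat \<Rightarrow> nat \<Rightarrow> nat \<Rightarrow> com" where
  "call p M a r = Seq (clear M) (Seq (Assign 0 (EVar a)) (Seq p (Assign r (EVar 0))))"

lemma exec_call:
  assumes "outputs_in p x t y" "cbound p \<le> M" "0 < M" "s a = x" "M \<le> a" "M \<le> r"
  shows "\<exists>s'. exec (call p M a r) s (t + M + 3) s' \<and> s' r = y
    \<and> (\<forall>v \<ge> M. v \<noteq> r \<longrightarrow> s' v = s v)"
proof -
  define s1 where "s1 = (\<lambda>v. if v < M then Leaf else s v)"
  define s2 where "s2 = s1(0 := x)"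
  have 1: "exec (clear M) s (Suc M) s1" using exec_clear assms unfolding s1_def by simp
  have 2: "exec (Assign 0 (EVar a)) s1 1 s2"
    using exec.Assign[of 0 "EVar a" s1] assms by (simp add: s1_def s2_def)
  obtain z where z: "exec p ((\<lambda>_. Leaf)(0 := x)) t z" "z 0 = y"
    using assms(1) unfolding outputs_in_def by auto
  \<comment> \<open>\<open>s2\<close> agrees with the start store of \<open>outputs_in\<close> only
    below \<open>M\<close>; the data of the caller above \<open>M\<close> survive by the frame
    property.\<close>
  obtain s3 where s3: "exec p s2 t s3" "\<forall>v < M. s3 v = z v" "\<forall>v \<ge> M. s3 v = s2 v"
    using exec_frame[OF z(1) assms(2), of s2] by (force simp: s2_def s1_def)
  have 4: "exec (Assign r (EVar 0)) s3 1 (s3(r := y))"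
    using exec.Assign[of r "EVar 0" s3] s3 z assms by simp
  have "exec (call p M a r) s (Suc M + (1 + (t + 1))) (s3(r := y))"
    unfolding call_def by (intro exec.Seq[OF 1] exec.Seq[OF 2] exec.Seq[OF s3(1)] 4)
  moreover have "\<forall>v \<ge> M. v \<noteq> r \<longrightarrow> (s3(r := y)) v = s v"
    using s3 assms by (auto simp: s2_def s1_def)
  ultimately show ?thesis by (intro exI[of _ "s3(r := y)"]) (simp add: eval_nat_numeral algebra_simps)
qed


section \<open>Sequencing, pairing and branching of programs\<close>

text \<open>One program and one constant overhead must serve all inputs, hence the order of
  quantifiers. Register \<open>M\<close>, untouched by both programs, carries the input, the
  intermediate result and the output in turn.\<close>

lemma outputs_comp:
  "\<exists>p''. \<exists>c. \<forall>x t y t' z. outputs_in p x t y \<longrightarrow> outputs_in p' y t' z \<longrightarrow> outputs_in p'' x (t + t' + c) z"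
proof -
  define M where "M = Suc (max (cbound p) (cbound p'))"
  have M: "cbound p \<le> M" "cbound p' \<le> M" "0 < M" by (auto simp: M_def)
  define q where "q = Seq (Assign M (EVar 0)) (Seq (call p M M M) (Seq (call p' M M M) (Assign 0 (EVar M))))"
  have "outputs_in q x (t + t' + (2 * M + 8)) z" if a: "outputs_in p x t y" "outputs_in p' y t' z" for x t y t' z
  proof -
    let ?s = "(\<lambda>_. Leaf)(0 := x)"
    let ?s1 = "?s(M := x)"
    have 1: "exec (Assign M (EVar 0)) ?s 1 ?s1" using exec.Assign[of M "EVar 0" ?s] by simp
    obtain s2 where 2: "exec (call p M M M) ?s1 (t + M + 3) s2" "s2 M = y"
      using exec_call[OF a(1) M(1,3), of ?s1 M M] by auto
    obtain s3 where 3: "exec (call p' M M M) s2 (t' + M + 3) s3" "s3 M = z"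
      using exec_call[OF a(2) M(2,3), of s2 M M] 2 by auto
    have 4: "exec (Assign 0 (EVar M)) s3 1 (s3(0 := z))" using exec.Assign[of 0 "EVar M" s3] 3 by simp
    have "exec q ?s (1 + ((t + M + 3) + ((t' + M + 3) + 1))) (s3(0 := z))"
      unfolding q_def by (intro exec.Seq[OF 1] exec.Seq[OF 2(1)] exec.Seq[OF 3(1)] 4)
    then show ?thesis unfolding outputs_in_def
      by (intro exI[of _ "s3(0 := z)"]) (simp add: algebra_simps)
  qed
  then show ?thesis by blast
qed

text \<open>The input stays in register \<open>M\<close>, so that the second program can be run on
  it after the first.\<close>

lemma outputs_pair:
  "\<exists>p''. \<exists>c. \<forall>x t y t' z. outputs_in p x t y \<longrightarrow> outputs_in p' x t' z \<longrightarrow> outputs_in p'' x (t + t' + c) (Branch y z)"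
proof -
  define M where "M = Suc (max (cbound p) (cbound p'))"
  have M: "cbound p \<le> M" "cbound p' \<le> M" "0 < M" by (auto simp: M_def)
  define q where "q = Seq (Assign M (EVar 0)) (Seq (call p M M (M+1)) (Seq (call p' M M (M+2)) (Assign 0 (EBranch (M+1) (M+2)))))"
  have "outputs_in q x (t + t' + (2 * M + 8)) (Branch y z)" if a: "outputs_in p x t y" "outputs_in p' x t' z" for x t y t' z
  proof -
    let ?s = "(\<lambda>_. Leaf)(0 := x)"
    let ?s1 = "?s(M := x)"
    have 1: "exec (Assign M (EVar 0)) ?s 1 ?s1" using exec.Assign[of M "EVar 0" ?s] by simp
    obtain s2 where 2: "exec (call p M M (M+1)) ?s1 (t + M + 3) s2" "s2 (M+1) = y"
       "\<forall>v \<ge> M. v \<noteq> M+1 \<longrightarrow> s2 v = ?s1 v"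
      using exec_call[OF a(1) M(1,3), of ?s1 M "M+1"] by auto
    have "s2 M = x" using 2(3) by simp
    then obtain s3 where 3: "exec (call p' M M (M+2)) s2 (t' + M + 3) s3" "s3 (M+2) = z"
       "\<forall>v \<ge> M. v \<noteq> M+2 \<longrightarrow> s3 v = s2 v"
      using exec_call[OF a(2) M(2,3), of s2 M "M+2"] by auto
    have "s3 (M+1) = y" using 2 3 by simp
    then have 4: "exec (Assign 0 (EBranch (M+1) (M+2))) s3 1 (s3(0 := Branch y z))" using exec.Assign[of 0 "EBranch (M+1) (M+2)" s3] 3 by simp
    have "exec q ?s (1 + ((t + M + 3) + ((t' + M + 3) + 1))) (s3(0 := Branch y z))"
      unfolding q_def by (intro exec.Seq[OF 1] exec.Seq[OF 2(1)] exec.Seq[OF 3(1)] 4)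
    then show ?thesis unfolding outputs_in_def
      by (intro exI[of _ "s3(0 := Branch y z)"]) (simp add: algebra_simps)
  qed
  then show ?thesis by blast
qed

text \<open>Only the branch that is taken is required to halt, which is why the second premise
  speaks of a conditional program.\<close>

lemma outputs_if:
  "\<exists>p''. \<exists>c. \<forall>x t b t' y. outputs_in p x t b \<longrightarrow> outputs_in (if b \<noteq> Leaf then p1 else p2) x t' y
     \<longrightarrow> outputs_in p'' x (t + t' + c) y"
proof -
  define M where "M = Suc (max (cbound p) (max (cbound p1) (cbound p2)))"
  have M: "cbound p \<le> M" "cbound (if b \<noteq> Leaf then p1 else p2) \<le> M" "0 < M" for b
    by (auto simp: M_def)
  define q where "q = Seq (Assign M (EVar 0)) (Seq (call p M M (M+1))
     (Seq (If (M+1) (call p1 M M M) (call p2 M M M)) (Assign 0 (EVar M))))"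
  have "outputs_in q x (t + t' + (2 * M + 9)) y"
    if a: "outputs_in p x t b" "outputs_in (if b \<noteq> Leaf then p1 else p2) x t' y" for x t b t' y
  proof -
    let ?s = "(\<lambda>_. Leaf)(0 := x)"
    let ?s1 = "?s(M := x)"
    have 1: "exec (Assign M (EVar 0)) ?s 1 ?s1" using exec.Assign[of M "EVar 0" ?s] by simp
    obtain s2 where 2: "exec (call p M M (M+1)) ?s1 (t + M + 3) s2" "s2 (M+1) = b"
       "\<forall>v \<ge> M. v \<noteq> M+1 \<longrightarrow> s2 v = ?s1 v"
      using exec_call[OF a(1) M(1,3), of ?s1 M "M+1"] by auto
    have "s2 M = x" using 2(3) by simp
    then obtain s3 where 3: "exec (call (if b \<noteq> Leaf then p1 else p2) M M M) s2 (t' + M + 3) s3" "s3 M = y"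
      using exec_call[OF a(2) M(2,3), of s2 M M] by auto
    have if3: "exec (If (M+1) (call p1 M M M) (call p2 M M M)) s2 (Suc (t' + M + 3)) s3"
    proof (cases "b = Leaf")
      case True
      show ?thesis by (rule exec.IfFalse) (use True 2(2) 3(1) in auto)
    next
      case False
      show ?thesis by (rule exec.IfTrue) (use False 2(2) 3(1) in auto)
    qed
    have 4: "exec (Assign 0 (EVar M)) s3 1 (s3(0 := y))" using exec.Assign[of 0 "EVar M" s3] 3 by simp
    have "exec q ?s (1 + ((t + M + 3) + (Suc (t' + M + 3) + 1))) (s3(0 := y))"
      unfolding q_def by (intro exec.Seq[OF 1] exec.Seq[OF 2(1)] exec.Seq[OF if3] 4)
    then show ?thesis unfolding outputs_in_def
      by (intro exI[of _ "s3(0 := y)"]) (simp add: algebra_simps)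
  qed
  then show ?thesis by blast
qed

section \<open>Loops over encoded lists\<close>

text \<open>Register \<open>M\<close> holds the environment, \<open>M + 1\<close> the rest of the list, \<open>M + 2\<close> the accumulator.\<close>

definition fold_com :: "com \<Rightarrow> nat \<Rightarrow> com" where
  "fold_com p M = While (M+1) (Seq (Assign (M+3) (ELeft (M+1))) (Seq (Assign (M+1) (ERight (M+1)))
     (Seq (Assign (M+3) (EBranch (M+3) (M+2))) (Seq (Assign (M+3) (EBranch M (M+3)))
     (call p M (M+3) (M+2))))))"

text \<open>The bound \<open>W\<close> is demanded only for accumulators that arise in this very
  fold, so it may depend on their sizes. A round costs the call, one test and four assignments,
  hence \<open>W + M + 8\<close>; the final 1 is the failing test.\<close>

lemma exec_fold_com:
  assumes "cbound p \<le> M" "0 < M"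
    and "\<And>ys x zs. xs = ys @ x # zs \<Longrightarrow> \<exists>t \<le> W.
        outputs_in p (Branch (ee e) (Branch (ex x) (es (fold (g e) ys a)))) t (es (g e x (fold (g e) ys a)))"
    and "s M = ee e" "s (M+1) = enc_list ex xs" "s (M+2) = es a"
  shows "\<exists>t s'. exec (fold_com p M) s t s' \<and> s' (M+2) = es (fold (g e) xs a)
     \<and> t \<le> length xs * (W + M + 8) + 1"
  using assms(3-)
proof (induction xs arbitrary: a s)
  case Nil
  then show ?case using exec.WhileFalse[of s "M+1"] unfolding fold_com_def by force
next
  case (Cons x xs)
  let ?s1 = "s(M+3 := ex x)"
  let ?s2 = "?s1(M+1 := enc_list ex xs)"
  let ?s3 = "?s2(M+3 := Branch (ex x) (es a))"
  let ?s4 = "?s3(M+3 := Branch (ee e) (Branch (ex x) (es a)))"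
  have 1: "exec (Assign (M+3) (ELeft (M+1))) s 1 ?s1"
    using exec.Assign[of "M+3" "ELeft (M+1)" s] Cons.prems by simp
  have 2: "exec (Assign (M+1) (ERight (M+1))) ?s1 1 ?s2"
    using exec.Assign[of "M+1" "ERight (M+1)" ?s1] Cons.prems by simp
  have 3: "exec (Assign (M+3) (EBranch (M+3) (M+2))) ?s2 1 ?s3"
    using exec.Assign[of "M+3" "EBranch (M+3) (M+2)" ?s2] Cons.prems by simp
  have 4: "exec (Assign (M+3) (EBranch M (M+3))) ?s3 1 ?s4"
    using exec.Assign[of "M+3" "EBranch M (M+3)" ?s3] Cons.prems by simp
  obtain t where t: "t \<le> W" "outputs_in p (Branch (ee e) (Branch (ex x) (es a))) t (es (g e x a))"
    using Cons.prems(1)[of "[]" x xs] by auto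
  obtain s5 where 5: "exec (call p M (M+3) (M+2)) ?s4 (t + M + 3) s5" "s5 (M+2) = es (g e x a)"
       "\<forall>v \<ge> M. v \<noteq> M+2 \<longrightarrow> s5 v = ?s4 v"
    using exec_call[OF t(2) assms(1,2), of ?s4 "M+3" "M+2"] by auto
  have "\<exists>t s'. exec (fold_com p M) s5 t s' \<and> s' (M+2) = es (fold (g e) xs (g e x a))
     \<and> t \<le> length xs * (W + M + 8) + 1"
  proof (rule Cons.IH)
    \<comment> \<open>A prefix \<open>ys\<close> of the tail corresponds to the prefix
      \<open>x # ys\<close> of the whole list.\<close>
    show "\<exists>t \<le> W. outputs_in p (Branch (ee e) (Branch (ex x') (es (fold (g e) ys (g e x a))))) t
          (es (g e x' (fold (g e) ys (g e x a))))" if "xs = ys @ x' # zs" for ys x' zs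
      using Cons.prems(1)[of "x # ys" x' zs] that by auto
    show "s5 M = ee e" "s5 (M+1) = enc_list ex xs" "s5 (M+2) = es (g e x a)" using 5 Cons.prems by auto
  qed
  then obtain t' s' where 6: "exec (fold_com p M) s5 t' s'" "s' (M+2) = es (fold (g e) xs (g e x a))"
     "t' \<le> length xs * (W + M + 8) + 1" by auto
  have "s (M+1) \<noteq> Leaf" using Cons.prems by simp
  from exec.WhileTrue[of s "M+1", OF this exec.Seq[OF 1 exec.Seq[OF 2 exec.Seq[OF 3 exec.Seq[OF 4 5(1)]]]] 6(1)[unfolded fold_com_def]]
  have "exec (fold_com p M) s (Suc (1 + (1 + (1 + (1 + (t + M + 3)))) + t')) s'"
    unfolding fold_com_def .
  moreover have "Suc (1 + (1 + (1 + (1 + (t + M + 3)))) + t') \<le> length (x # xs) * (W + M + 8) + 1"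
    using 6(3) t(1) by simp
  moreover have "s' (M+2) = es (fold (g e) (x # xs) a)" using 6(2) by simp
  ultimately show ?case by blast
qed

definition fold_reg :: "com \<Rightarrow> com \<Rightarrow> com \<Rightarrow> com \<Rightarrow> nat" where
  "fold_reg p pe pl pa = Suc (max (max (cbound p) (cbound pe)) (max (cbound pl) (cbound pa)))"

text \<open>Register \<open>M + 3\<close> keeps the input while environment, list and initial
  accumulator are computed from it; afterwards the loop uses it as scratch space.\<close>

definition fold_prog :: "com \<Rightarrow> com \<Rightarrow> com \<Rightarrow> com \<Rightarrow> com" where
  "fold_prog p pe pl pa = (let M = fold_reg p pe pl pa in
     Seq (Assign (M+3) (EVar 0)) (Seq (call pe M (M+3) M) (Seq (call pl M (M+3) (M+1))
     (Seq (call pa M (M+3) (M+2)) (Seq (fold_com p M) (Assign 0 (EVar (M+2))))))))"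

text \<open>The constant \<open>c\<close> is the cost outside the rounds (three call overheads, two
  copies and the last loop test), and it also dominates the overhead \<open>M + 8\<close> of a
  round.\<close>

lemma outputs_fold:
  assumes a: "outputs_in pe x te (ee e)" "outputs_in pl x tx (enc_list ex xs)" "outputs_in pa x ta (es a)"
    and step: "\<And>ys x zs. xs = ys @ x # zs \<Longrightarrow> \<exists>t \<le> W.
        outputs_in p (Branch (ee e) (Branch (ex x) (es (fold (g e) ys a)))) t (es (g e x (fold (g e) ys a)))"
    and c: "c = 3 * fold_reg p pe pl pa + 12"
  shows "\<exists>t \<le> te + tx + ta + length xs * (W + c) + c.
     outputs_in (fold_prog p pe pl pa) x t (es (fold (g e) xs a))"
proof -
  define M where "M = fold_reg p pe pl pa"
  let ?q = "fold_prog p pe pl pa"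
  have M: "0 < M" "cbound p \<le> M" "cbound pe \<le> M" "cbound pl \<le> M" "cbound pa \<le> M"
    by (auto simp: M_def fold_reg_def)
  let ?s = "(\<lambda>_. Leaf)(0 := x)"
  let ?s1 = "?s(M + 3 := x)"
  have 1: "exec (Assign (M+3) (EVar 0)) ?s 1 ?s1" using exec.Assign[of "M+3" "EVar 0" ?s] by simp
  obtain s2 where 2: "exec (call pe M (M+3) M) ?s1 (te + M + 3) s2" "s2 M = ee e"
     "\<forall>v \<ge> M. v \<noteq> M \<longrightarrow> s2 v = ?s1 v"
    using exec_call[OF a(1) M(3) M(1), of ?s1 "M+3" M] by auto
  have "s2 (M+3) = x" using 2(3) by simp
  then obtain s3 where 3: "exec (call pl M (M+3) (M+1)) s2 (tx + M + 3) s3" "s3 (M+1) = enc_list ex xs"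
     "\<forall>v \<ge> M. v \<noteq> M+1 \<longrightarrow> s3 v = s2 v"
    using exec_call[OF a(2) M(4) M(1), of s2 "M+3" "M+1"] by auto
  have "s3 (M+3) = x" using 2(3) 3(3) by simp
  then obtain s4 where 4: "exec (call pa M (M+3) (M+2)) s3 (ta + M + 3) s4" "s4 (M+2) = es a"
     "\<forall>v \<ge> M. v \<noteq> M+2 \<longrightarrow> s4 v = s3 v"
    using exec_call[OF a(3) M(5) M(1), of s3 "M+3" "M+2"] by auto
  have "s4 M = ee e" "s4 (M+1) = enc_list ex xs" using 2 3 4 by auto
  then obtain t s5 where 5: "exec (fold_com p M) s4 t s5" "s5 (M+2) = es (fold (g e) xs a)"
     "t \<le> length xs * (W + M + 8) + 1"
    using exec_fold_com[OF M(2,1), of xs W ee e ex es g a s4] step 4(2) by auto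
  have 6: "exec (Assign 0 (EVar (M+2))) s5 1 (s5(0 := es (fold (g e) xs a)))"
    using exec.Assign[of 0 "EVar (M+2)" s5] 5 by simp
  have "exec ?q ?s (1 + ((te + M + 3) + ((tx + M + 3) + ((ta + M + 3) + (t + 1))))) (s5(0 := es (fold (g e) xs a)))"
    unfolding fold_prog_def M_def[symmetric] Let_def by (intro exec.Seq[OF 1] exec.Seq[OF 2(1)] exec.Seq[OF 3(1)] exec.Seq[OF 4(1)] exec.Seq[OF 5(1)] 6)
  moreover have "1 + ((te + M + 3) + ((tx + M + 3) + ((ta + M + 3) + (t + 1)))) \<le> te + tx + ta + length xs * (W + c) + c"
    using 5(3) unfolding c M_def[symmetric] by (simp add: algebra_simps)
  ultimately show ?thesis unfolding outputs_in_def by (metis fun_upd_same)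
qed

subsection \<open>Polynomial-time computable functions\<close>

text \<open>With \<open>Suc (m a)\<close> the base is at least 1, so raising the exponent never
  lowers the bound and constants are absorbed.\<close>

definition poly_bounded :: "('a \<Rightarrow> nat) \<Rightarrow> ('a \<Rightarrow> nat) \<Rightarrow> bool" where
  "poly_bounded m f \<longleftrightarrow> (\<exists>c e. \<forall>a. f a \<le> c * Suc (m a) ^ e)"

lemma poly_bounded_mono: "poly_bounded m g \<Longrightarrow> (\<And>a. f a \<le> g a) \<Longrightarrow> poly_bounded m f"
  unfolding poly_bounded_def by (meson le_trans)

lemma poly_bounded_const [simp]: "poly_bounded m (\<lambda>_. c)"
  unfolding poly_bounded_def by (rule exI[of _ c], rule exI[of _ 0]) simp

lemma poly_bounded_self [simp]: "poly_bounded m m"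
  unfolding poly_bounded_def by (rule exI[of _ 1], rule exI[of _ 1]) simp

lemma poly_bounded_add:
  assumes "poly_bounded m f" "poly_bounded m g"
  shows "poly_bounded m (\<lambda>a. f a + g a)"
proof -
  obtain c e c' e' where *: "\<And>a. f a \<le> c * Suc (m a) ^ e" "\<And>a. g a \<le> c' * Suc (m a) ^ e'"
    using assms unfolding poly_bounded_def by blast
  have "f a + g a \<le> (c + c') * Suc (m a) ^ (e + e')" for a
  proof -
    have "Suc (m a) ^ e \<le> Suc (m a) ^ (e + e')" "Suc (m a) ^ e' \<le> Suc (m a) ^ (e + e')"
      by (intro power_increasing; simp)+
    then have "c * Suc (m a) ^ e \<le> c * Suc (m a) ^ (e + e')" "c' * Suc (m a) ^ e' \<le> c' * Suc (m a) ^ (e + e')"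
      by (simp_all only: mult_le_mono2)
    then show ?thesis using *[of a] by (simp only: add_mult_distrib)
  qed
  then show ?thesis unfolding poly_bounded_def by blast
qed

lemma poly_bounded_mult:
  assumes "poly_bounded m f" "poly_bounded m g"
  shows "poly_bounded m (\<lambda>a. f a * g a)"
proof -
  obtain c e c' e' where *: "\<And>a. f a \<le> c * Suc (m a) ^ e" "\<And>a. g a \<le> c' * Suc (m a) ^ e'"
    using assms unfolding poly_bounded_def by blast
  have "f a * g a \<le> (c * c') * Suc (m a) ^ (e + e')" for a
    using mult_le_mono[OF *[of a]] by (simp only: power_add mult_ac)
  then show ?thesis unfolding poly_bounded_def by blast
qed

lemma poly_bounded_Suc: "poly_bounded m f \<Longrightarrow> poly_bounded m (\<lambda>a. Suc (f a))"
  using poly_bounded_add[of m f "\<lambda>_. 1"] by simp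

lemma poly_bounded_power: "poly_bounded m f \<Longrightarrow> poly_bounded m (\<lambda>a. f a ^ n)"
  by (induction n) (auto intro: poly_bounded_mult)

lemma poly_bounded_comp:
  assumes "poly_bounded m' f" "poly_bounded m (\<lambda>a. m' (h a))"
  shows "poly_bounded m (\<lambda>a. f (h a))"
proof -
  obtain c e where "\<And>a. f a \<le> c * Suc (m' a) ^ e"
    using assms unfolding poly_bounded_def by blast
  then show ?thesis
    by (intro poly_bounded_mono[where f = "\<lambda>a. f (h a)" and g = "\<lambda>a. c * Suc (m' (h a)) ^ e"]
        poly_bounded_mult poly_bounded_power poly_bounded_Suc assms(2)) auto
qed

lemmas poly_bounded_intros = poly_bounded_const poly_bounded_self poly_bounded_add poly_bounded_mult
  poly_bounded_Suc poly_bounded_power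

text \<open>The measure \<open>m\<close> is separate from the input size because the reduction is
  polynomial only in a measure that counts the universe as well. Output size is bounded separately:
  with shared subtrees, a linear number of steps can build a tree of exponential size.\<close>

definition poly_computes :: "('a \<Rightarrow> tree) \<Rightarrow> ('a \<Rightarrow> nat) \<Rightarrow> ('a \<Rightarrow> tree) \<Rightarrow> bool" where
  "poly_computes i m f \<longleftrightarrow> poly_bounded m (\<lambda>a. tree_size (f a)) \<and>
     (\<exists>p T. poly_bounded m T \<and> (\<forall>a. \<exists>t \<le> T a. outputs_in p (i a) t (f a)))"

abbreviation poly_time where "poly_time i \<equiv> poly_computes i (\<lambda>a. tree_size (i a))"

lemma poly_computes_size: "poly_computes i m f \<Longrightarrow> poly_bounded m (\<lambda>a. tree_size (f a))"
  by (simp add: poly_computes_def)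

section \<open>Closure under composition, tree operations and case distinction\<close>

lemma poly_computes_id:
  assumes "poly_bounded m (\<lambda>a. tree_size (i a))"
  shows "poly_computes i m i"
proof -
  have "outputs_in (Assign 0 (EVar 0)) x 1 x" for x
    using exec.Assign[of 0 "EVar 0"] unfolding outputs_in_def by fastforce
  then show ?thesis unfolding poly_computes_def using assms
    by (intro conjI exI[of _ "Assign 0 (EVar 0)"] exI[of _ "\<lambda>_. 1"]) auto
qed

lemma poly_computes_trans:
  assumes "poly_computes i m f" "poly_computes f m g"
  shows "poly_computes i m g"
proof -
  obtain p T p' T' where p: "poly_bounded m T" "\<And>a. \<exists>t \<le> T a. outputs_in p (i a) t (f a)"
    "poly_bounded m T'" "\<And>a. \<exists>t \<le> T' a. outputs_in p' (f a) t (g a)"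
    using assms unfolding poly_computes_def by blast
  obtain q c where q: "\<And>x t y t' z. outputs_in p x t y \<Longrightarrow> outputs_in p' y t' z \<Longrightarrow> outputs_in q x (t + t' + c) z"
    using outputs_comp by blast
  have "\<exists>t \<le> T a + T' a + c. outputs_in q (i a) t (g a)" for a
    using p(2)[of a] p(4)[of a] q[of "i a" _ "f a" _ "g a"] by (meson add_le_mono le_refl)
  then show ?thesis using assms p(1,3) unfolding poly_computes_def
    by (intro conjI exI[of _ q] exI[of _ "\<lambda>a. T a + T' a + c"] poly_bounded_intros) auto
qed

lemma poly_computes_reindex:
  assumes "poly_computes i m f" "poly_bounded m' (\<lambda>b. m (h b))"
  shows "poly_computes (\<lambda>b. i (h b)) m' (\<lambda>b. f (h b))"
proof -
  obtain p T where p: "poly_bounded m T" "\<And>a. \<exists>t \<le> T a. outputs_in p (i a) t (f a)"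
    using assms unfolding poly_computes_def by blast
  show ?thesis
    unfolding poly_computes_def
    using poly_bounded_comp[OF poly_computes_size[OF assms(1)] assms(2)]
      poly_bounded_comp[OF p(1) assms(2)] p(2)
    by (intro conjI exI[of _ p] exI[of _ "\<lambda>b. T (h b)"]) auto
qed

text \<open>A function that is polynomial in its own argument can be applied to any computed
  argument, since the size of that argument is itself polynomial in \<open>m\<close>.\<close>

lemma poly_computes_comp:
  assumes "poly_time i' f" "poly_computes i m (\<lambda>a. i' (h a))"
  shows "poly_computes i m (\<lambda>a. f (h a))"
  using poly_computes_trans[OF assms(2) poly_computes_reindex[OF assms(1)]]
    poly_computes_size[OF assms(2)] by blast

lemma poly_computes_Branch:
  assumes "poly_computes i m f" "poly_computes i m g"
  shows "poly_computes i m (\<lambda>a. Branch (f a) (g a))"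
proof -
  obtain p T p' T' where p: "poly_bounded m T" "\<And>a. \<exists>t \<le> T a. outputs_in p (i a) t (f a)"
    "poly_bounded m T'" "\<And>a. \<exists>t \<le> T' a. outputs_in p' (i a) t (g a)"
    using assms unfolding poly_computes_def by blast
  obtain q c where q: "\<And>x t y t' z. outputs_in p x t y \<Longrightarrow> outputs_in p' x t' z \<Longrightarrow> outputs_in q x (t + t' + c) (Branch y z)"
    using outputs_pair by blast
  have "\<exists>t \<le> T a + T' a + c. outputs_in q (i a) t (Branch (f a) (g a))" for a
    using p(2)[of a] p(4)[of a] q[of "i a" _ "f a" _ "g a"] by (meson add_le_mono le_refl)
  moreover have "poly_bounded m (\<lambda>a. tree_size (Branch (f a) (g a)))"
    using assms by (auto intro!: poly_bounded_intros dest: poly_computes_size)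
  ultimately show ?thesis using p(1,3) unfolding poly_computes_def
    by (intro conjI exI[of _ q] exI[of _ "\<lambda>a. T a + T' a + c"] poly_bounded_intros) auto
qed

lemma poly_time_expr:
  assumes "\<And>x. tree_size (expr_val e ((\<lambda>_. Leaf)(0 := x))) \<le> tree_size x"
  shows "poly_time (\<lambda>x. x) (\<lambda>x. expr_val e ((\<lambda>_. Leaf)(0 := x)))"
proof -
  have "outputs_in (Assign 0 e) x 1 (expr_val e ((\<lambda>_. Leaf)(0 := x)))" for x
    using exec.Assign[of 0 e] unfolding outputs_in_def by fastforce
  then show ?thesis unfolding poly_computes_def
    using poly_bounded_mono[OF poly_bounded_self assms]
    by (intro conjI exI[of _ "Assign 0 e"] exI[of _ "\<lambda>_. 1"]) auto
qed

lemma poly_computes_left: "poly_computes i m f \<Longrightarrow> poly_computes i m (\<lambda>a. left (f a))"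
proof (rule poly_computes_comp[where i' = "\<lambda>x. x" and h = f])
  have "tree_size (left x) \<le> tree_size x" for x by (cases x) auto
  then show "poly_time (\<lambda>x. x) left"
    using poly_time_expr[of "ELeft 0"] by simp
qed

lemma poly_computes_right: "poly_computes i m f \<Longrightarrow> poly_computes i m (\<lambda>a. right (f a))"
proof (rule poly_computes_comp[where i' = "\<lambda>x. x" and h = f])
  have "tree_size (right x) \<le> tree_size x" for x by (cases x) auto
  then show "poly_time (\<lambda>x. x) right"
    using poly_time_expr[of "ERight 0"] by simp
qed

lemma poly_computes_const: "poly_computes i m (\<lambda>_. c)"
proof (induction c)
  case Leaf
  have "outputs_in (Assign 0 ELeaf) x 1 Leaf" for x
    using exec.Assign[of 0 ELeaf] unfolding outputs_in_def by fastforce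
  then show ?case unfolding poly_computes_def
    by (intro conjI exI[of _ "Assign 0 ELeaf"] exI[of _ "\<lambda>_. 1"]) auto
next
  case (Branch c1 c2)
  then show ?case by (rule poly_computes_Branch)
qed

lemma poly_computes_If:
  assumes "poly_computes i m f" "poly_computes i m g1" "poly_computes i m g2"
  shows "poly_computes i m (\<lambda>a. if f a \<noteq> Leaf then g1 a else g2 a)"
proof -
  obtain p T p1 T1 p2 T2 where p: "poly_bounded m T" "\<And>a. \<exists>t \<le> T a. outputs_in p (i a) t (f a)"
    "poly_bounded m T1" "\<And>a. \<exists>t \<le> T1 a. outputs_in p1 (i a) t (g1 a)"
    "poly_bounded m T2" "\<And>a. \<exists>t \<le> T2 a. outputs_in p2 (i a) t (g2 a)"
    using assms unfolding poly_computes_def by blast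
  obtain q c where q: "\<And>x t b t' y. outputs_in p x t b \<Longrightarrow> outputs_in (if b \<noteq> Leaf then p1 else p2) x t' y
     \<Longrightarrow> outputs_in q x (t + t' + c) y"
    using outputs_if by blast
  have "\<exists>t \<le> T a + (T1 a + T2 a) + c. outputs_in q (i a) t (if f a \<noteq> Leaf then g1 a else g2 a)" for a
  proof -
    obtain t where t: "t \<le> T a" "outputs_in p (i a) t (f a)" using p(2) by blast
    have "\<exists>t' \<le> T1 a + T2 a. outputs_in (if f a \<noteq> Leaf then p1 else p2) (i a) t' (if f a \<noteq> Leaf then g1 a else g2 a)"
      using p(4)[of a] p(6)[of a] by (auto intro: trans_le_add1 trans_le_add2)
    then obtain t' where "t' \<le> T1 a + T2 a" "outputs_in (if f a \<noteq> Leaf then p1 else p2) (i a) t' (if f a \<noteq> Leaf then g1 a else g2 a)"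
      by blast
    then show ?thesis using q[OF t(2)] t(1) by (meson add_le_mono le_refl)
  qed
  moreover have "poly_bounded m (\<lambda>a. tree_size (if f a \<noteq> Leaf then g1 a else g2 a))"
    using poly_bounded_add[OF poly_computes_size[OF assms(2)] poly_computes_size[OF assms(3)]]
    by (rule poly_bounded_mono) auto
  ultimately show ?thesis using p(1,3,5) unfolding poly_computes_def
    by (intro conjI exI[of _ q] exI[of _ "\<lambda>a. T a + (T1 a + T2 a) + c"] poly_bounded_intros) auto
qed

section \<open>Iteration over lists with controlled growth\<close>

lemma length_le_enc_list: "length xs \<le> tree_size (enc_list ex xs)"
  by (induction xs) auto

lemma mem_le_enc_list: "x \<in> set xs \<Longrightarrow> tree_size (ex x) \<le> tree_size (enc_list ex xs)"
  by (induction xs) auto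

text \<open>Iterating a polynomial-time step may blow up the accumulator, so a polynomial bound
  \<open>S\<close> on all intermediate accumulators is an assumption. Under it every round has
  polynomial cost, and there are at most as many rounds as the list has size.\<close>

lemma poly_computes_fold:
  fixes ee :: "'e \<Rightarrow> tree" and ex :: "'x \<Rightarrow> tree" and es :: "'s \<Rightarrow> tree"
  assumes step: "poly_time (\<lambda>(e, x, s). Branch (ee e) (Branch (ex x) (es s))) (\<lambda>(e, x, s). es (g e x s))"
    and e: "poly_computes i m (\<lambda>a. ee (e a))"
    and xs: "poly_computes i m (\<lambda>a. enc_list ex (xs a))"
    and s: "poly_computes i m (\<lambda>a. es (s a))"
    and S: "poly_bounded m S" "\<And>a ys zs. xs a = ys @ zs \<Longrightarrow> tree_size (es (fold (g (e a)) ys (s a))) \<le> S a"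
  shows "poly_computes i m (\<lambda>a. es (fold (g (e a)) (xs a) (s a)))"
proof -
  let ?is = "\<lambda>(e, x, s). Branch (ee e) (Branch (ex x) (es s))"
  obtain pe Te where e': "poly_bounded m Te" "\<And>a. \<exists>t \<le> Te a. outputs_in pe (i a) t (ee (e a))"
    using e unfolding poly_computes_def by blast
  obtain px Tx where x': "poly_bounded m Tx" "\<And>a. \<exists>t \<le> Tx a. outputs_in px (i a) t (enc_list ex (xs a))"
    using xs unfolding poly_computes_def by blast
  obtain ps Ts where s': "poly_bounded m Ts" "\<And>a. \<exists>t \<le> Ts a. outputs_in ps (i a) t (es (s a))"
    using s unfolding poly_computes_def by blast
  obtain p T where pT: "poly_bounded (\<lambda>a. tree_size (?is a)) T"
     "\<And>a. \<exists>t \<le> T a. outputs_in p (?is a) t (case a of (e, x, s) \<Rightarrow> es (g e x s))"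
    using step unfolding poly_computes_def by blast
  obtain c d where cd: "\<And>a. T a \<le> c * Suc (tree_size (?is a)) ^ d"
    using pT(1) unfolding poly_bounded_def by blast
  have p: "\<exists>t \<le> c * Suc (tree_size (?is (e, x, s))) ^ d. outputs_in p (Branch (ee e) (Branch (ex x) (es s))) t (es (g e x s))" for e x s
    using pT(2)[of "(e,x,s)"] cd[of "(e,x,s)"] by (auto intro: order_trans)
  \<comment> \<open>The size of the whole list stands in for that of a single element; the 2 counts
    the two \<open>Branch\<close> nodes that pack the arguments of a step.\<close>
  define W where "W a = c * Suc (tree_size (ee (e a)) + tree_size (enc_list ex (xs a)) + S a + 2) ^ d" for a
  have W: "poly_bounded m W"
    unfolding W_def by (intro poly_bounded_intros poly_computes_size[OF e] poly_computes_size[OF xs] S(1))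
  define q where "q = fold_prog p pe px ps"
  define k where "k = 3 * fold_reg p pe px ps + 12"
  define R where "R a = Te a + Tx a + Ts a + tree_size (enc_list ex (xs a)) * (W a + k) + k" for a
  have "\<exists>t \<le> R a. outputs_in q (i a) t (es (fold (g (e a)) (xs a) (s a)))" for a
  proof -
    obtain te tl ta where t: "te \<le> Te a" "tl \<le> Tx a" "ta \<le> Ts a" "outputs_in pe (i a) te (ee (e a))"
      "outputs_in px (i a) tl (enc_list ex (xs a))" "outputs_in ps (i a) ta (es (s a))"
      using e'(2)[of a] x'(2)[of a] s'(2)[of a] by blast
    have "\<exists>t \<le> te + tl + ta + length (xs a) * (W a + k) + k. outputs_in q (i a) t (es (fold (g (e a)) (xs a) (s a)))"
      unfolding q_def
    proof (rule outputs_fold[where ee = ee and ex = ex and es = es and e = "e a" and xs = "xs a" and a = "s a" and g = g, OF t(4-6) _ k_def])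
      fix ys x zs assume *: "xs a = ys @ x # zs"
      let ?s = "fold (g (e a)) ys (s a)"
      have "tree_size (ex x) \<le> tree_size (enc_list ex (xs a))" using * by (intro mem_le_enc_list) auto
      then have "c * Suc (tree_size (?is (e a, x, ?s))) ^ d \<le> W a"
        unfolding W_def using S(2)[OF *] by (intro mult_le_mono2 power_mono) auto
      then show "\<exists>t \<le> W a. outputs_in p (Branch (ee (e a)) (Branch (ex x) (es ?s))) t (es (g (e a) x ?s))"
        using p[of "e a" x ?s] order_trans by blast
    qed
    moreover have "te + tl + ta + length (xs a) * (W a + k) + k \<le> R a"
      unfolding R_def using t(1-3) length_le_enc_list[of "xs a" ex]
      by (intro add_le_mono mult_le_mono) auto
    ultimately show ?thesis by (meson order_trans)
  qed
  moreover have "poly_bounded m R" unfolding R_def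
    by (intro poly_bounded_intros e' x' s' W poly_computes_size[OF xs])
  moreover have "poly_bounded m (\<lambda>a. tree_size (es (fold (g (e a)) (xs a) (s a))))"
    by (rule poly_bounded_mono[OF S(1)]) (use S(2) in auto)
  ultimately show ?thesis unfolding poly_computes_def by blast
qed

lemma fold_size_le:
  assumes "\<And>x s. x \<in> set xs \<Longrightarrow> tree_size (es (g x s)) \<le> tree_size (es s) + c"
  shows "tree_size (es (fold g xs s)) \<le> tree_size (es s) + length xs * c"
  using assms
proof (induction xs arbitrary: s)
  case (Cons x xs)
  have "tree_size (es (fold g xs (g x s))) \<le> tree_size (es (g x s)) + length xs * c" using Cons by auto
  then show ?case using Cons.prems[of x s] by auto
qed simp

text \<open>If a step adds an amount that does not depend on the accumulator, the size grows at most
  linearly with the number of rounds, and this yields the bound \<open>S\<close>.\<close>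

lemma poly_computes_fold_additive:
  fixes ee :: "'e \<Rightarrow> tree" and ex :: "'x \<Rightarrow> tree" and es :: "'s \<Rightarrow> tree"
  assumes step: "poly_time (\<lambda>(e, x, s). Branch (ee e) (Branch (ex x) (es s))) (\<lambda>(e, x, s). es (g e x s))"
    and e: "poly_computes i m (\<lambda>a. ee (e a))"
    and xs: "poly_computes i m (\<lambda>a. enc_list ex (xs a))"
    and s: "poly_computes i m (\<lambda>a. es (s a))"
    and R: "poly_bounded (\<lambda>(e, x). tree_size (ee e) + tree_size (ex x)) (\<lambda>(e, x). R e x)"
    and S: "\<And>e x s. tree_size (es (g e x s)) \<le> tree_size (es s) + R e x"
  shows "poly_computes i m (\<lambda>a. es (fold (g (e a)) (xs a) (s a)))"
proof -
  obtain c d where cd: "\<And>e x. R e x \<le> c * Suc (tree_size (ee e) + tree_size (ex x)) ^ d"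
    using R unfolding poly_bounded_def by auto
  define C where "C a = c * Suc (tree_size (ee (e a)) + tree_size (enc_list ex (xs a))) ^ d" for a
  let ?S = "\<lambda>a. tree_size (es (s a)) + tree_size (enc_list ex (xs a)) * C a"
  show ?thesis
  proof (rule poly_computes_fold[OF step e xs s])
    show "poly_bounded m ?S" unfolding C_def
      by (intro poly_bounded_intros poly_computes_size[OF e] poly_computes_size[OF xs] poly_computes_size[OF s])
    fix a ys zs assume *: "xs a = ys @ zs"
    have "tree_size (es (fold (g (e a)) ys (s a))) \<le> tree_size (es (s a)) + length ys * C a"
    proof (rule fold_size_le)
      fix x s' assume "x \<in> set ys"
      then have "tree_size (ex x) \<le> tree_size (enc_list ex (xs a))" using * by (intro mem_le_enc_list) auto
      then have "c * Suc (tree_size (ee (e a)) + tree_size (ex x)) ^ d \<le> C a"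
        unfolding C_def by (intro mult_le_mono2 power_mono) auto
      then show "tree_size (es (g (e a) x s')) \<le> tree_size (es s') + C a"
        using S[of "e a" x s'] cd[of "e a" x] by linarith
    qed
    moreover have "length ys * C a \<le> tree_size (enc_list ex (xs a)) * C a"
      using length_le_enc_list[of "xs a" ex] * by (intro mult_le_mono1) auto
    ultimately show "tree_size (es (fold (g (e a)) ys (s a))) \<le> ?S a" by linarith
  qed
qed

lemma poly_computes_cong:
  "poly_computes i m f \<Longrightarrow> (\<And>a. f a = g a) \<Longrightarrow> poly_computes i m g"
  by (metis ext)

lemma poly_time_step_arg:
  fixes ee :: "'e \<Rightarrow> tree" and ex :: "'x \<Rightarrow> tree" and es :: "'s \<Rightarrow> tree"
  defines "i \<equiv> \<lambda>(e, x, s). Branch (ee e) (Branch (ex x) (es s))"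
  shows "poly_time i (\<lambda>a. ee (fst a))" "poly_time i (\<lambda>a. ex (fst (snd a)))" "poly_time i (\<lambda>a. es (snd (snd a)))"
proof -
  have i: "poly_time i i" by (rule poly_computes_id) simp
  note r = poly_computes_right[OF i]
  show "poly_time i (\<lambda>a. ee (fst a))"
    by (rule poly_computes_cong[OF poly_computes_left[OF i]]) (auto simp: i_def)
  show "poly_time i (\<lambda>a. ex (fst (snd a)))"
    by (rule poly_computes_cong[OF poly_computes_left[OF r]]) (auto simp: i_def)
  show "poly_time i (\<lambda>a. es (snd (snd a)))"
    by (rule poly_computes_cong[OF poly_computes_right[OF r]]) (auto simp: i_def)
qed

subsection \<open>The reduction and its running time\<close>

lemma tree_size_enc_nat [simp]: "tree_size (enc_nat n) = 2 * n + 1"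
  by (induction n) auto

lemma enc_pair_eq: "enc_pair e e' p = Branch (e (fst p)) (e' (snd p))"
  by (cases p) simp

lemma enc_bool_neq_Leaf [simp]: "enc_bool b \<noteq> Leaf \<longleftrightarrow> b"
  by (cases b) auto

lemma enc_nat_eq_Leaf [simp]: "enc_nat n = Leaf \<longleftrightarrow> n = 0"
  by (cases n) auto

text \<open>A unary number is a list of units, so counting loops are folds too.\<close>

lemma enc_nat_eq_enc_list: "enc_nat n = enc_list (\<lambda>_. Leaf) (replicate n ())"
  by (induction n) auto

section \<open>Construction of the formula\<close>

text \<open>\<open>Neg (Eq 0 0)\<close> serves as falsity, the empty disjunction. It mentions
  variable 0, the variable of the example, which therefore is formally free.\<close>

definition var_fo :: "nat list \<Rightarrow> nat \<Rightarrow> fo" where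
  "var_fo zs v = fold (\<lambda>z \<phi>. Disj (Rel v [z]) \<phi>) zs (Neg (Eq 0 0))"

definition lit_fo :: "nat list \<Rightarrow> literal \<Rightarrow> fo" where
  "lit_fo zs l = (if snd l then var_fo zs (fst l) else Neg (var_fo zs (fst l)))"

definition clause_fo :: "nat list \<Rightarrow> clause \<Rightarrow> fo" where
  "clause_fo zs C = Disj (lit_fo zs (fst C)) (Disj (lit_fo zs (fst (snd C))) (lit_fo zs (snd (snd C))))"

definition cnf_fo :: "nat list \<Rightarrow> clause list \<Rightarrow> fo" where
  "cnf_fo zs F = fold (\<lambda>C \<phi>. Conj (clause_fo zs C) \<phi>) F (Eq 0 0)"

definition sat_fo :: "nat list \<Rightarrow> clause list \<Rightarrow> fo" where
  "sat_fo zs F = fold Ex zs (cnf_fo zs F)"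

text \<open>A biconditional spelled out; variable 0 is the example and variable 1 the
  parameter.\<close>

definition learn_fo :: "nat list \<Rightarrow> clause list \<Rightarrow> fo" where
  "learn_fo zs F = Disj (Conj (Eq 0 1) (sat_fo zs F)) (Conj (Neg (Eq 0 1)) (Neg (sat_fo zs F)))"

lemmas poly_computes_intros = poly_computes_const poly_computes_Branch

lemma poly_computes_var_fo:
  assumes "poly_computes i m (\<lambda>a. enc_list enc_nat (zs a))" "poly_computes i m (\<lambda>a. enc_nat (v a))"
  shows "poly_computes i m (\<lambda>a. enc_fo (var_fo (zs a) (v a)))"
  unfolding var_fo_def
proof (rule poly_computes_fold_additive[where ee = enc_nat and ex = enc_nat and es = enc_fo
      and e = v and g = "\<lambda>v z \<phi>. Disj (Rel v [z]) \<phi>" and R = "\<lambda>v z. 2 * v + 2 * z + 20"])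
  show "poly_time (\<lambda>(e, x, s). Branch (enc_nat e) (Branch (enc_nat x) (enc_fo s)))
     (\<lambda>(e, x, s). enc_fo (Disj (Rel e [x]) s))"
    unfolding split_def enc_fo.simps enc_list.simps
    by (intro poly_computes_intros poly_time_step_arg[unfolded split_def])
  show "poly_computes i m (\<lambda>a. enc_fo (Neg (Eq 0 0)))" by (rule poly_computes_const)
  show "poly_bounded (\<lambda>(e, x). tree_size (enc_nat e) + tree_size (enc_nat x)) (\<lambda>(e, x). 2 * e + 2 * x + 20)"
    unfolding poly_bounded_def by (intro exI[of _ 20] exI[of _ 1]) auto
qed (use assms in auto)

lemma poly_computes_lit_fo:
  assumes "poly_computes i m (\<lambda>a. enc_list enc_nat (zs a))" "poly_computes i m (\<lambda>a. enc_pair enc_nat enc_bool (l a))"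
  shows "poly_computes i m (\<lambda>a. enc_fo (lit_fo (zs a) (l a)))"
proof -
  have v: "poly_computes i m (\<lambda>a. enc_nat (fst (l a)))"
    by (rule poly_computes_cong[OF poly_computes_left[OF assms(2)]]) (simp add: enc_pair_eq)
  have s: "poly_computes i m (\<lambda>a. enc_bool (snd (l a)))"
    by (rule poly_computes_cong[OF poly_computes_right[OF assms(2)]]) (simp add: enc_pair_eq)
  note f = poly_computes_var_fo[OF assms(1) v]
  have "poly_computes i m (\<lambda>a. Branch (enc_nat 2) (enc_fo (var_fo (zs a) (fst (l a)))))"
    by (intro poly_computes_intros f)
  from poly_computes_If[OF s f this] show ?thesis
    by (rule poly_computes_cong) (simp add: lit_fo_def)
qed

lemma poly_computes_clause_fo:
  assumes z: "poly_computes i m (\<lambda>a. enc_list enc_nat (zs a))"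
    and C: "poly_computes i m (\<lambda>a. enc_pair (enc_pair enc_nat enc_bool)
        (enc_pair (enc_pair enc_nat enc_bool) (enc_pair enc_nat enc_bool)) (C a))"
  shows "poly_computes i m (\<lambda>a. enc_fo (clause_fo (zs a) (C a)))"
proof -
  have r: "poly_computes i m (\<lambda>a. enc_pair (enc_pair enc_nat enc_bool) (enc_pair enc_nat enc_bool) (snd (C a)))"
    by (rule poly_computes_cong[OF poly_computes_right[OF C]]) (simp add: enc_pair_eq)
  show ?thesis unfolding clause_fo_def enc_fo.simps
  proof (intro poly_computes_intros poly_computes_lit_fo z)
    show "poly_computes i m (\<lambda>a. enc_pair enc_nat enc_bool (fst (C a)))"
      by (rule poly_computes_cong[OF poly_computes_left[OF C]]) (simp add: enc_pair_eq)
    show "poly_computes i m (\<lambda>a. enc_pair enc_nat enc_bool (fst (snd (C a))))"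
      by (rule poly_computes_cong[OF poly_computes_left[OF r]]) (simp add: enc_pair_eq)
    show "poly_computes i m (\<lambda>a. enc_pair enc_nat enc_bool (snd (snd (C a))))"
      by (rule poly_computes_cong[OF poly_computes_right[OF r]]) (simp add: enc_pair_eq)
  qed
qed

abbreviation enc_clause :: "clause \<Rightarrow> tree" where
  "enc_clause \<equiv> enc_pair (enc_pair enc_nat enc_bool) (enc_pair (enc_pair enc_nat enc_bool) (enc_pair enc_nat enc_bool))"

lemma poly_computes_cnf_fo:
  assumes z: "poly_computes i m (\<lambda>a. enc_list enc_nat (zs a))"
    and F: "poly_computes i m (\<lambda>a. enc_list enc_clause (F a))"
  shows "poly_computes i m (\<lambda>a. enc_fo (cnf_fo (zs a) (F a)))"
proof -
  let ?i = "\<lambda>(zs, C). Branch (enc_list enc_nat zs) (enc_clause C)"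
  have i: "poly_time ?i ?i" by (rule poly_computes_id) simp
  have "poly_time ?i (\<lambda>a. enc_list enc_nat (fst a))"
    by (rule poly_computes_cong[OF poly_computes_left[OF i]]) auto
  moreover have "poly_time ?i (\<lambda>a. enc_clause (snd a))"
    by (rule poly_computes_cong[OF poly_computes_right[OF i]]) auto
  ultimately have "poly_time ?i (\<lambda>a. enc_fo (clause_fo (fst a) (snd a)))"
    by (rule poly_computes_clause_fo)
  \<comment> \<open>The growth per clause is read off from the computability of
    \<open>clause_fo\<close>, which includes a polynomial size bound.\<close>
  from poly_computes_size[OF this]
  have "poly_bounded (\<lambda>(e, x). tree_size (enc_list enc_nat e) + tree_size (enc_clause x)) (\<lambda>a. tree_size (enc_fo (clause_fo (fst a) (snd a))))"
    by (rule poly_bounded_comp[where h = "\<lambda>x. x"])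
      (rule poly_bounded_mono[OF poly_bounded_Suc[OF poly_bounded_self]], auto)
  then have R: "poly_bounded (\<lambda>(e, x). tree_size (enc_list enc_nat e) + tree_size (enc_clause x)) (\<lambda>(e, x). tree_size (enc_fo (clause_fo e x)) + 10)"
    unfolding split_def by (intro poly_bounded_intros)
  show ?thesis unfolding cnf_fo_def
  proof (rule poly_computes_fold_additive[where ee = "enc_list enc_nat" and ex = enc_clause and es = enc_fo
      and e = zs and g = "\<lambda>zs C \<phi>. Conj (clause_fo zs C) \<phi>", OF _ z F _ R])
    show "poly_time (\<lambda>(e, x, s). Branch (enc_list enc_nat e) (Branch (enc_clause x) (enc_fo s)))
       (\<lambda>(e, x, s). enc_fo (Conj (clause_fo e x) s))"
      unfolding split_def enc_fo.simps
      by (intro poly_computes_intros poly_computes_clause_fo poly_time_step_arg[unfolded split_def])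
    show "poly_computes i m (\<lambda>a. enc_fo (Eq 0 0))" by (rule poly_computes_const)
  qed auto
qed

lemma poly_computes_sat_fo:
  assumes z: "poly_computes i m (\<lambda>a. enc_list enc_nat (zs a))"
    and F: "poly_computes i m (\<lambda>a. enc_list enc_clause (F a))"
  shows "poly_computes i m (\<lambda>a. enc_fo (sat_fo (zs a) (F a)))"
  unfolding sat_fo_def
proof (rule poly_computes_fold_additive[where ee = "\<lambda>_ :: unit. Leaf" and ex = enc_nat and es = enc_fo
      and g = "\<lambda>_. Ex" and R = "\<lambda>_ z. 2 * z + 20", OF _ poly_computes_const z poly_computes_cnf_fo[OF z F]])
  show "poly_time (\<lambda>(e, x, s). Branch Leaf (Branch (enc_nat x) (enc_fo s))) (\<lambda>(e :: unit, x, s). enc_fo (Ex x s))"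
    unfolding split_def enc_fo.simps
    by (intro poly_computes_intros poly_time_step_arg[unfolded split_def])
  show "poly_bounded (\<lambda>(e, x). tree_size Leaf + tree_size (enc_nat x)) (\<lambda>(e :: unit, x). 2 * x + 20)"
    unfolding poly_bounded_def by (intro exI[of _ 20] exI[of _ 1]) auto
qed auto

lemma poly_computes_learn_fo:
  assumes "poly_computes i m (\<lambda>a. enc_list enc_nat (zs a))" "poly_computes i m (\<lambda>a. enc_list enc_clause (F a))"
  shows "poly_computes i m (\<lambda>a. enc_fo (learn_fo (zs a) (F a)))"
  unfolding learn_fo_def enc_fo.simps
  by (intro poly_computes_intros poly_computes_sat_fo assms)

lemma poly_computes_vocab:
  assumes "poly_computes i m (\<lambda>a. enc_nat (n a))"
  shows "poly_computes i m (\<lambda>a. enc_list enc_nat (replicate (n a) 1))"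
proof -
  have "poly_computes i m (\<lambda>a. enc_list enc_nat (fold (\<lambda>_. (#) 1) (replicate (n a) ()) []))"
  proof (rule poly_computes_fold_additive[where ee = "\<lambda>_ :: unit. Leaf" and ex = "\<lambda>_ :: unit. Leaf" and es = "enc_list enc_nat"
      and g = "\<lambda>_ _. (#) 1" and R = "\<lambda>_ _. 5", OF _ poly_computes_const assms[unfolded enc_nat_eq_enc_list] poly_computes_const])
    show "poly_time (\<lambda>(e :: unit, x :: unit, s). Branch Leaf (Branch Leaf (enc_list enc_nat s)))
      (\<lambda>(e, x, s). enc_list enc_nat (1 # s))"
      unfolding split_def enc_list.simps
      by (intro poly_computes_intros poly_time_step_arg[unfolded split_def])
  qed (auto simp: split_def)
  moreover have "fold (\<lambda>_. (#) 1) (replicate j ()) l = replicate j (1 :: nat) @ l" for j l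
    by (induction j arbitrary: l) (auto simp flip: replicate_append_same)
  ultimately show ?thesis by simp
qed

section \<open>Building the universe by dealing variables to blocks\<close>

text \<open>A row \<open>(c, w)\<close> is an element of the universe under construction: \<open>w\<close> lists the truth values
  that it assigns to the variables seen so far, and the variable whose value it may choose comes
  after \<open>c\<close> others.\<close>

definition expand_row :: "nat \<Rightarrow> nat \<times> bool list \<Rightarrow> (nat \<times> bool list) list \<Rightarrow> (nat \<times> bool list) list" where
  "expand_row k r rs = (if fst r \<noteq> 0 then (fst r - 1, False # snd r) # rs
     else (k, True # snd r) # (k, False # snd r) # rs)"

text \<open>One empty row per block. With rounds counted from 0, the rows descending from counter
  \<open>c\<close> choose in the rounds congruent to \<open>c\<close> modulo
  \<open>Suc k\<close>.\<close>

definition init_rows :: "nat \<Rightarrow> (nat \<times> bool list) list" where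
  "init_rows k = map (\<lambda>c. (c, [])) [0..<Suc k]"

text \<open>Each round treats one variable and prepends its value, so variable \<open>v\<close> ends
  up at position \<open>n - 1 - v\<close> of a row.\<close>

definition rows :: "nat \<Rightarrow> nat \<Rightarrow> (nat \<times> bool list) list" where
  "rows k n = ((\<lambda>rs. fold (expand_row k) rs []) ^^ n) (init_rows k)"

lemma rows_0: "rows k 0 = init_rows k"
  by (simp add: rows_def)

lemma rows_Suc: "rows k (Suc n) = fold (expand_row k) (rows k n) []"
  by (simp add: rows_def)

lemma set_fold_expand_row:
  "set (fold (expand_row k) rs a) = set a \<union> (\<Union>r \<in> set rs. set (expand_row k r []))"
  by (induction rs arbitrary: a) (auto simp: expand_row_def)

lemma length_fold_expand_row:
  "length a + length rs \<le> length (fold (expand_row k) rs a)"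
proof (induction rs arbitrary: a)
  case (Cons r rs)
  show ?case using Cons[of "expand_row k r a"] by (auto simp: expand_row_def split: if_splits)
qed simp

text \<open>Every row has at least one successor, so the last table is the longest and its length
  controls all intermediate ones.\<close>

lemma length_rows_mono: "i \<le> j \<Longrightarrow> length (rows k i) \<le> length (rows k j)"
proof (induction j rule: dec_induct)
  case (step n)
  then show ?case using length_fold_expand_row[of "[]" "rows k n" k] by (simp add: rows_Suc)
qed simp

lemma rows_bounds: "r \<in> set (rows k n) \<Longrightarrow> fst r \<le> k \<and> length (snd r) = n"
proof (induction n arbitrary: r)
  case 0
  then show ?case by (auto simp: rows_0 init_rows_def)
next
  case (Suc n)
  then show ?case by (fastforce simp: rows_Suc set_fold_expand_row expand_row_def split: if_splits)
qed

abbreviation enc_row :: "nat \<times> bool list \<Rightarrow> tree" where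
  "enc_row \<equiv> enc_pair enc_nat (enc_list enc_bool)"

lemma poly_time_expand_row:
  "poly_time (\<lambda>(e, x, s). Branch (enc_nat e) (Branch (enc_row x) (enc_list enc_row s)))
     (\<lambda>(e, x, s). enc_list enc_row (expand_row e x s))"
proof -
  let ?i = "\<lambda>(e, x, s). Branch (enc_nat e) (Branch (enc_row x) (enc_list enc_row s))"
  note a = poly_time_step_arg[where ee = enc_nat and ex = enc_row and es = "enc_list enc_row"]
  have c: "poly_time ?i (\<lambda>a. enc_nat (fst (fst (snd a))))"
    by (rule poly_computes_cong[OF poly_computes_left[OF a(2)]]) (simp add: enc_pair_eq)
  have w: "poly_time ?i (\<lambda>a. enc_list enc_bool (snd (fst (snd a))))"
    by (rule poly_computes_cong[OF poly_computes_right[OF a(2)]]) (simp add: enc_pair_eq)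
  have "right (enc_nat j) = enc_nat (j - 1)" for j by (cases j) auto
  then have d: "poly_time ?i (\<lambda>a. enc_nat (fst (fst (snd a)) - 1))"
    by (intro poly_computes_cong[OF poly_computes_right[OF c]]) simp
  have 1: "poly_time ?i (\<lambda>a. enc_list enc_row ((fst (fst (snd a)) - 1, False # snd (fst (snd a))) # snd (snd a)))"
    unfolding enc_list.simps enc_pair.simps by (intro poly_computes_intros a d w)
  have 2: "poly_time ?i (\<lambda>a. enc_list enc_row ((fst a, True # snd (fst (snd a))) # (fst a, False # snd (fst (snd a))) # snd (snd a)))"
    unfolding enc_list.simps enc_pair.simps by (intro poly_computes_intros a w)
  show ?thesis
    by (rule poly_computes_cong[OF poly_computes_If[OF c 1 2]]) (auto simp: expand_row_def split_def)
qed

lemma poly_computes_expand_rows: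
  assumes "poly_computes i m (\<lambda>a. enc_nat (k a))" "poly_computes i m (\<lambda>a. enc_list enc_row (rs a))"
  shows "poly_computes i m (\<lambda>a. enc_list enc_row (fold (expand_row (k a)) (rs a) []))"
proof (rule poly_computes_fold_additive[where R = "\<lambda>k r. 2 * (2 * k + tree_size (enc_row r) + 20)",
     OF poly_time_expand_row assms poly_computes_const])
  show "poly_bounded (\<lambda>(e, x). tree_size (enc_nat e) + tree_size (enc_row x)) (\<lambda>(e, x). 2 * (2 * e + tree_size (enc_row x) + 20))"
    unfolding poly_bounded_def by (intro exI[of _ 40] exI[of _ 1]) auto
qed (auto simp: expand_row_def enc_pair_eq)

lemma enc_list_size_le:
  "(\<And>x. x \<in> set xs \<Longrightarrow> tree_size (e x) \<le> b) \<Longrightarrow> tree_size (enc_list e xs) \<le> 1 + length xs * (b + 1)"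
proof (induction xs)
  case (Cons x xs)
  then show ?case using Cons.prems[of x] by force
qed simp

lemma enc_rows_size_le:
  assumes "j \<le> n"
  shows "tree_size (enc_list enc_row (rows k j)) \<le> 1 + length (rows k n) * (2 * k + 4 * n + 4)"
proof -
  have bool: "tree_size (enc_bool b) \<le> 3" for b by (cases b) auto
  have "tree_size (enc_list enc_row (rows k j)) \<le> 1 + length (rows k j) * ((2 * k + 4 * n + 3) + 1)"
  proof (rule enc_list_size_le)
    fix r assume r: "r \<in> set (rows k j)"
    have "tree_size (enc_list enc_bool (snd r)) \<le> 1 + length (snd r) * (3 + 1)"
      by (rule enc_list_size_le) (rule bool)
    then show "tree_size (enc_row r) \<le> 2 * k + 4 * n + 3"
      using rows_bounds[OF r] assms by (simp add: enc_pair_eq)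
  qed
  also have "\<dots> \<le> 1 + length (rows k n) * ((2 * k + 4 * n + 3) + 1)"
    using length_rows_mono[OF assms] by (intro add_le_mono mult_le_mono) auto
  finally show ?thesis by (simp add: ac_simps)
qed

lemma fold_replicate: "fold (\<lambda>_. f) (replicate n x) s = (f ^^ n) s"
  by (induction n arbitrary: s) (auto simp: funpow_swap1)

text \<open>Identifies the intermediate states of a counting loop as the states after
  \<open>j\<close> rounds.\<close>

lemma append_eq_replicateD: "replicate n () = ys @ zs \<Longrightarrow> \<exists>j \<le> n. ys = replicate j ()"
  by (metis append_eq_conv_conj le_add1 length_append length_replicate replicate_length_same unit.exhaust)

text \<open>The growth in a round depends on the table itself, so it is not additive. The bound on
  intermediate tables comes from the measure, which is assumed to control the final number of
  rows.\<close>

lemma poly_computes_rows: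
  assumes k: "poly_computes i m (\<lambda>a. enc_nat (k a))" and n: "poly_computes i m (\<lambda>a. enc_nat (n a))"
    and r0: "poly_computes i m (\<lambda>a. enc_list enc_row (init_rows (k a)))"
    and m: "poly_bounded m (\<lambda>a. length (rows (k a) (n a)))"
  shows "poly_computes i m (\<lambda>a. enc_list enc_row (rows (k a) (n a)))"
proof -
  have "poly_computes i m (\<lambda>a. enc_list enc_row (fold ((\<lambda>k _ rs. fold (expand_row k) rs []) (k a)) (replicate (n a) ()) (init_rows (k a))))"
  proof (rule poly_computes_fold[where ee = enc_nat and ex = "\<lambda>_. Leaf" and es = "enc_list enc_row" and e = k
      and g = "\<lambda>k _ rs. fold (expand_row k) rs []", OF _ k n[unfolded enc_nat_eq_enc_list] r0,
      where S = "\<lambda>a. 1 + length (rows (k a) (n a)) * (tree_size (enc_nat (k a)) + 2 * tree_size (enc_nat (n a)) + 4)"])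
    show "poly_time (\<lambda>(e, x, s). Branch (enc_nat e) (Branch Leaf (enc_list enc_row s)))
      (\<lambda>(e, x :: unit, s). enc_list enc_row (fold (expand_row e) s []))"
      unfolding split_def
      by (intro poly_computes_expand_rows poly_time_step_arg[unfolded split_def])
    show "poly_bounded m (\<lambda>a. 1 + length (rows (k a) (n a)) * (tree_size (enc_nat (k a)) + 2 * tree_size (enc_nat (n a)) + 4))"
      by (intro poly_bounded_intros m poly_computes_size[OF k] poly_computes_size[OF n])
    fix a ys zs assume "replicate (n a) () = ys @ zs"
    then obtain j where j: "j \<le> n a" "ys = replicate j ()" using append_eq_replicateD by blast
    show "tree_size (enc_list enc_row (fold (\<lambda>_ rs. fold (expand_row (k a)) rs []) ys (init_rows (k a))))
       \<le> 1 + length (rows (k a) (n a)) * (tree_size (enc_nat (k a)) + 2 * tree_size (enc_nat (n a)) + 4)"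
      using enc_rows_size_le[OF j(1), of "k a"] unfolding j(2) fold_replicate rows_def[symmetric]
      by (rule order_trans) (auto intro!: mult_le_mono)
  qed
  then show ?thesis by (simp add: fold_replicate rows_def)
qed

section \<open>Numbering the elements of the universe\<close>

text \<open>The block counter of a row has done its work and gives way to the position of the row,
  its name in the universe. The running index ends as the size of the universe.\<close>

definition index_row :: "nat \<times> bool list \<Rightarrow> nat \<times> (nat \<times> bool list) list \<Rightarrow> nat \<times> (nat \<times> bool list) list" where
  "index_row r s = (Suc (fst s), (fst s, snd r) # snd s)"

lemma fold_index_row:
  "fold index_row rs (i, l) = (i + length rs, rev (zip [i..<i + length rs] (map snd rs)) @ l)"
  by (induction rs arbitrary: i l) (auto simp: index_row_def upt_conv_Cons simp del: upt_Suc)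

abbreviation enc_indexed :: "nat \<times> (nat \<times> bool list) list \<Rightarrow> tree" where
  "enc_indexed \<equiv> enc_pair enc_nat (enc_list enc_row)"

text \<open>The index attached in a step is part of the accumulator, so growth is not additive; the
  bound uses that all indices are below the length of the list.\<close>

lemma poly_computes_index_rows:
  assumes rs: "poly_computes i m (\<lambda>a. enc_list enc_row (rs a))"
  shows "poly_computes i m (\<lambda>a. enc_indexed (fold index_row (rs a) (0, [])))"
proof (rule poly_computes_fold[where ee = "\<lambda>_ :: unit. Leaf" and ex = enc_row and es = enc_indexed
      and g = "\<lambda>_. index_row", OF _ poly_computes_const rs])
  let ?i = "\<lambda>(e :: unit, x, s). Branch Leaf (Branch (enc_row x) (enc_indexed s))"
  note a = poly_time_step_arg[where ee = "\<lambda>_ :: unit. Leaf" and ex = enc_row and es = enc_indexed]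
  have w: "poly_time ?i (\<lambda>a. enc_list enc_bool (snd (fst (snd a))))"
    by (rule poly_computes_cong[OF poly_computes_right[OF a(2)]]) (simp add: enc_pair_eq)
  have n: "poly_time ?i (\<lambda>a. enc_nat (fst (snd (snd a))))"
    by (rule poly_computes_cong[OF poly_computes_left[OF a(3)]]) (simp add: enc_pair_eq)
  have l: "poly_time ?i (\<lambda>a. enc_list enc_row (snd (snd (snd a))))"
    by (rule poly_computes_cong[OF poly_computes_right[OF a(3)]]) (simp add: enc_pair_eq)
  have "poly_time ?i (\<lambda>a. enc_indexed (index_row (fst (snd a)) (snd (snd a))))"
    unfolding index_row_def enc_pair.simps enc_list.simps enc_nat.simps
    by (intro poly_computes_intros w n l)
  then show "poly_time ?i (\<lambda>(e, x, s). enc_indexed (index_row x s))"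
    by (rule poly_computes_cong) auto
  show "poly_computes i m (\<lambda>a. enc_indexed (0, []))" by (rule poly_computes_const)
  let ?L = "\<lambda>a. tree_size (enc_list enc_row (rs a))"
  show "poly_bounded m (\<lambda>a. 2 * ?L a + 3 + ?L a * (3 * ?L a + 3))"
    by (intro poly_bounded_intros poly_computes_size[OF rs])
  fix a ys zs assume rs: "rs a = ys @ zs"
  define l where "l = rev (zip [0..<length ys] (map snd ys))"
  have L: "length ys \<le> ?L a" using length_le_enc_list[of "rs a" enc_row] rs by simp
  have "tree_size (enc_list enc_row l) \<le> 1 + length l * ((3 * ?L a + 2) + 1)"
  proof (rule enc_list_size_le)
    fix r assume "r \<in> set l"
    then obtain j w where j: "r = (j, w)" "j < length ys" "w \<in> snd ` set ys"
      unfolding l_def by (force simp: set_zip)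
    then obtain r' where r': "r' \<in> set (rs a)" "w = snd r'" using rs by auto
    have "tree_size (enc_list enc_bool w) \<le> tree_size (enc_row r')" using r' by (simp add: enc_pair_eq)
    also have "\<dots> \<le> ?L a" by (rule mem_le_enc_list[OF r'(1)])
    finally show "tree_size (enc_row r) \<le> 3 * ?L a + 2" using j L by simp
  qed
  also have "\<dots> \<le> 1 + ?L a * (3 * ?L a + 3)"
    by (rule add_le_mono[OF le_refl], rule mult_le_mono) (use L in \<open>auto simp: l_def\<close>)
  finally show "tree_size (enc_indexed (fold index_row ys (0, []))) \<le> 2 * ?L a + 3 + ?L a * (3 * ?L a + 3)"
    using L by (simp add: fold_index_row l_def[symmetric])
qed

section \<open>Transposing rows into unary relations\<close>

text \<open>The guard \<open>snd r \<noteq> []\<close> mirrors the program, where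
  \<open>left\<close> of an empty list is \<open>Leaf\<close> and reads as false, while
  \<open>hd []\<close> is unspecified.\<close>

definition split_row :: "nat \<times> bool list \<Rightarrow> (nat \<times> bool list) list \<times> nat list list \<Rightarrow> (nat \<times> bool list) list \<times> nat list list" where
  "split_row r s = ((fst r, tl (snd r)) # fst s, if snd r \<noteq> [] \<and> hd (snd r) then [fst r] # snd s else snd s)"

definition split_column :: "(nat \<times> bool list) list \<times> nat list list list \<Rightarrow> (nat \<times> bool list) list \<times> nat list list list" where
  "split_column s = (let s' = fold split_row (fst s) ([], []) in (fst s', snd s' # snd s))"

text \<open>A matrix transposition. Heads are removed from first to last and tables are prepended,
  which undoes the reversal inside the rows: table \<open>v\<close> belongs to the variable of round
  \<open>v\<close>.\<close>

definition columns :: "nat \<Rightarrow> (nat \<times> bool list) list \<Rightarrow> nat list list list" where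
  "columns n rs = snd ((split_column ^^ n) (rs, []))"

abbreviation enc_split :: "(nat \<times> bool list) list \<times> nat list list \<Rightarrow> tree" where
  "enc_split \<equiv> enc_pair (enc_list enc_row) (enc_list enc_tuple)"

abbreviation enc_columns :: "(nat \<times> bool list) list \<times> nat list list list \<Rightarrow> tree" where
  "enc_columns \<equiv> enc_pair (enc_list enc_row) (enc_list (enc_list enc_tuple))"

lemma enc_tuple_singleton: "enc_tuple [x] = Branch (enc_nat x) Leaf"
  by (simp add: enc_tuple_def)

lemma right_enc_list: "right (enc_list e xs) = enc_list e (tl xs)"
  by (cases xs) auto

lemma left_enc_list_bool: "left (enc_list enc_bool w) \<noteq> Leaf \<longleftrightarrow> w \<noteq> [] \<and> hd w"
  by (cases w) auto

lemma tree_size_tl: "tree_size (enc_list e (tl xs)) \<le> tree_size (enc_list e xs)"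
  by (cases xs) auto

lemma poly_computes_split_rows:
  assumes rs: "poly_computes i m (\<lambda>a. enc_list enc_row (rs a))"
  shows "poly_computes i m (\<lambda>a. enc_split (fold split_row (rs a) ([], [])))"
proof (rule poly_computes_fold_additive[where ee = "\<lambda>_ :: unit. Leaf" and ex = enc_row and es = enc_split
      and g = "\<lambda>_. split_row" and R = "\<lambda>_ r. 2 * tree_size (enc_row r) + 10", OF _ poly_computes_const rs])
  let ?i = "\<lambda>(e :: unit, x, s). Branch Leaf (Branch (enc_row x) (enc_split s))"
  note a = poly_time_step_arg[where ee = "\<lambda>_ :: unit. Leaf" and ex = enc_row and es = enc_split]
  have n: "poly_time ?i (\<lambda>a. enc_nat (fst (fst (snd a))))"
    by (rule poly_computes_cong[OF poly_computes_left[OF a(2)]]) (simp add: enc_pair_eq)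
  have w: "poly_time ?i (\<lambda>a. enc_list enc_bool (snd (fst (snd a))))"
    by (rule poly_computes_cong[OF poly_computes_right[OF a(2)]]) (simp add: enc_pair_eq)
  note hd = poly_computes_left[OF w]
  have tl: "poly_time ?i (\<lambda>a. enc_list enc_bool (tl (snd (fst (snd a)))))"
    by (rule poly_computes_cong[OF poly_computes_right[OF w]]) (simp add: right_enc_list)
  have l: "poly_time ?i (\<lambda>a. enc_list enc_row (fst (snd (snd a))))"
    by (rule poly_computes_cong[OF poly_computes_left[OF a(3)]]) (simp add: enc_pair_eq)
  have t: "poly_time ?i (\<lambda>a. enc_list enc_tuple (snd (snd (snd a))))"
    by (rule poly_computes_cong[OF poly_computes_right[OF a(3)]]) (simp add: enc_pair_eq)
  have t': "poly_time ?i (\<lambda>a. enc_list enc_tuple ([fst (fst (snd a))] # snd (snd (snd a))))"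
    unfolding enc_list.simps enc_tuple_singleton by (intro poly_computes_intros n t)
  have "poly_time ?i (\<lambda>a. Branch (Branch (enc_row (fst (fst (snd a)), tl (snd (fst (snd a))))) (enc_list enc_row (fst (snd (snd a)))))
    (if left (enc_list enc_bool (snd (fst (snd a)))) \<noteq> Leaf
      then enc_list enc_tuple ([fst (fst (snd a))] # snd (snd (snd a))) else enc_list enc_tuple (snd (snd (snd a)))))"
    unfolding enc_pair.simps by (intro poly_computes_Branch poly_computes_If n tl l t t' hd)
  then show "poly_time ?i (\<lambda>(e, x, s). enc_split (split_row x s))"
    by (rule poly_computes_cong) (auto simp: split_row_def left_enc_list_bool simp del: left.simps)
  show "poly_computes i m (\<lambda>a. enc_split ([], []))" by (rule poly_computes_const)
  show "poly_bounded (\<lambda>(e :: unit, x). tree_size Leaf + tree_size (enc_row x)) (\<lambda>(e :: unit, x). 2 * tree_size (enc_row x) + 10)"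
    unfolding poly_bounded_def by (intro exI[of _ 20] exI[of _ 1]) auto
  show "tree_size (enc_split (split_row r s)) \<le> tree_size (enc_split s) + (2 * tree_size (enc_row r) + 10)" for r s
    using tree_size_tl[of enc_bool "snd r"] by (cases s) (auto simp: split_row_def enc_pair_eq enc_tuple_def)
qed

lemma poly_computes_split_column:
  assumes s: "poly_computes i m (\<lambda>a. enc_columns (s a))"
  shows "poly_computes i m (\<lambda>a. enc_columns (split_column (s a)))"
proof -
  have rs: "poly_computes i m (\<lambda>a. enc_list enc_row (fst (s a)))"
    by (rule poly_computes_cong[OF poly_computes_left[OF s]]) (simp add: enc_pair_eq)
  have cs: "poly_computes i m (\<lambda>a. enc_list (enc_list enc_tuple) (snd (s a)))"
    by (rule poly_computes_cong[OF poly_computes_right[OF s]]) (simp add: enc_pair_eq)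
  note f = poly_computes_split_rows[OF rs]
  have 1: "poly_computes i m (\<lambda>a. enc_list enc_row (fst (fold split_row (fst (s a)) ([], []))))"
    by (rule poly_computes_cong[OF poly_computes_left[OF f]]) (simp add: enc_pair_eq)
  have 2: "poly_computes i m (\<lambda>a. enc_list enc_tuple (snd (fold split_row (fst (s a)) ([], []))))"
    by (rule poly_computes_cong[OF poly_computes_right[OF f]]) (simp add: enc_pair_eq)
  show ?thesis unfolding split_column_def Let_def enc_pair.simps enc_list.simps
    by (intro poly_computes_intros 1 2 cs)
qed

lemma fold_split_row:
  "fold split_row rs (a, b) = (rev (map (\<lambda>r. (fst r, tl (snd r))) rs) @ a,
     rev (map (\<lambda>r. [fst r]) (filter (\<lambda>r. snd r \<noteq> [] \<and> hd (snd r)) rs)) @ b)"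
  by (induction rs arbitrary: a b) (auto simp: split_row_def)

lemma split_column_eq:
  "split_column s = (rev (map (\<lambda>r. (fst r, tl (snd r))) (fst s)),
     rev (map (\<lambda>r. [fst r]) (filter (\<lambda>r. snd r \<noteq> [] \<and> hd (snd r)) (fst s))) # snd s)"
  by (simp add: split_column_def fold_split_row)

lemma tree_size_enc_list_append:
  "tree_size (enc_list e (xs @ ys)) + 1 = tree_size (enc_list e xs) + tree_size (enc_list e ys)"
  by (induction xs) auto

lemma tree_size_enc_list_rev: "tree_size (enc_list e (rev xs)) = tree_size (enc_list e xs)"
proof (induction xs)
  case (Cons x xs)
  then show ?case using tree_size_enc_list_append[of e "rev xs" "[x]"] by simp
qed simp

lemma split_column_size:
  "tree_size (enc_list enc_row (fst (split_column s))) \<le> tree_size (enc_list enc_row (fst s))"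
  "tree_size (enc_list (enc_list enc_tuple) (snd (split_column s)))
     \<le> tree_size (enc_list (enc_list enc_tuple) (snd s)) + 3 * tree_size (enc_list enc_row (fst s)) + 1"
proof -
  have "tree_size (enc_list enc_row (map (\<lambda>r. (fst r, tl (snd r))) rs)) \<le> tree_size (enc_list enc_row rs)" for rs
  proof (induction rs)
    case (Cons r rs)
    then show ?case using tree_size_tl[of enc_bool "snd r"] by (simp add: enc_pair_eq)
  qed simp
  then show "tree_size (enc_list enc_row (fst (split_column s))) \<le> tree_size (enc_list enc_row (fst s))"
    by (simp add: split_column_eq tree_size_enc_list_rev)
  have "tree_size (enc_list enc_tuple (map (\<lambda>r. [fst r]) (filter P rs))) \<le> 3 * tree_size (enc_list enc_row rs)" for rs P
    by (induction rs) (auto simp: enc_pair_eq enc_tuple_def)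
  then show "tree_size (enc_list (enc_list enc_tuple) (snd (split_column s)))
     \<le> tree_size (enc_list (enc_list enc_tuple) (snd s)) + 3 * tree_size (enc_list enc_row (fst s)) + 1"
    by (simp add: split_column_eq tree_size_enc_list_rev)
qed

text \<open>A new table is bounded in terms of the rows that remain, and these never grow; so the
  tables together grow linearly with the number of rounds.\<close>

lemma split_columns_size:
  defines "s \<equiv> \<lambda>j rs. (split_column ^^ j) (rs, [])"
  shows "tree_size (enc_list enc_row (fst (s j rs))) \<le> tree_size (enc_list enc_row rs)
   \<and> tree_size (enc_list (enc_list enc_tuple) (snd (s j rs))) \<le> 1 + j * (3 * tree_size (enc_list enc_row rs) + 1)"
proof (induction j)
  case (Suc j)
  then show ?case using split_column_size[of "s j rs"] by (simp add: s_def)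
qed (simp add: s_def)

lemma poly_computes_columns:
  assumes n: "poly_computes i m (\<lambda>a. enc_nat (n a))"
    and rs: "poly_computes i m (\<lambda>a. enc_list enc_row (rs a))"
  shows "poly_computes i m (\<lambda>a. enc_list (enc_list enc_tuple) (columns (n a) (rs a)))"
proof -
  let ?L = "\<lambda>a. tree_size (enc_list enc_row (rs a))"
  let ?N = "\<lambda>a. tree_size (enc_nat (n a))"
  have s: "poly_computes i m (\<lambda>a. enc_columns (rs a, []))"
    unfolding enc_pair.simps enc_list.simps by (intro poly_computes_intros rs)
  have "poly_computes i m (\<lambda>a. enc_columns (fold (\<lambda>_. split_column) (replicate (n a) ()) (rs a, [])))"
  proof (rule poly_computes_fold[where ee = "\<lambda>_ :: unit. Leaf" and ex = "\<lambda>_. Leaf" and es = enc_columns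
      and g = "\<lambda>_ _. split_column", OF _ poly_computes_const n[unfolded enc_nat_eq_enc_list] s])
    have "poly_time (\<lambda>(e :: unit, x :: unit, s). Branch Leaf (Branch Leaf (enc_columns s))) (\<lambda>a. enc_columns (split_column (snd (snd a))))"
      by (intro poly_computes_split_column poly_time_step_arg)
    then show "poly_time (\<lambda>(e :: unit, x :: unit, s). Branch Leaf (Branch Leaf (enc_columns s))) (\<lambda>(e, x, s). enc_columns (split_column s))"
      by (rule poly_computes_cong) auto
    show "poly_bounded m (\<lambda>a. 1 + ?L a + (1 + ?N a * (3 * ?L a + 1)))"
      by (intro poly_bounded_intros poly_computes_size[OF n] poly_computes_size[OF rs])
    fix a ys zs assume "replicate (n a) () = ys @ zs"
    then obtain j where j: "j \<le> n a" "ys = replicate j ()" using append_eq_replicateD by blast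
    have "j * (3 * ?L a + 1) \<le> ?N a * (3 * ?L a + 1)" using j by (intro mult_le_mono1) simp
    then show "tree_size (enc_columns (fold (\<lambda>_. split_column) ys (rs a, []))) \<le> 1 + ?L a + (1 + ?N a * (3 * ?L a + 1))"
      using split_columns_size[of j "rs a"] by (simp add: j(2) fold_replicate enc_pair_eq)
  qed
  from poly_computes_right[OF this] show ?thesis
    by (rule poly_computes_cong) (simp add: enc_pair_eq fold_replicate columns_def)
qed

section \<open>Assembling the learning instance\<close>

text \<open>There are \<open>Suc k\<close> blocks and as many quantified variables, numbered from 2
  because 0 and 1 are the example and the parameter.\<close>

definition reduction :: "nat \<Rightarrow> nat \<Rightarrow> clause list \<Rightarrow> learning_instance" where
  "reduction k n F =
     \<lparr>rank = Suc k, formula = learn_fo [2..<k + 3] F, xvars = [0], yvars = [1], vocab = replicate n 1,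
      usize = length (rows k n),
      tables = columns n (snd (fold index_row (rows k n) (0, []))),
      training = [([0], True)]\<rparr>"

text \<open>Everything that depends on \<open>k\<close> alone is handed to the program ready-made;
  once \<open>k\<close> is fixed, it is a constant tree.\<close>

definition enc_rank :: "nat \<Rightarrow> tree" where
  "enc_rank k = Branch (enc_nat k) (Branch (enc_list enc_nat [2..<k + 3]) (enc_list enc_row (init_rows k)))"

text \<open>Since \<open>k\<close> belongs to the input, one program and one polynomial serve all
  ranks. The number of rows has to enter the measure, as the output can be exponential in
  \<open>n\<close>.\<close>

lemma poly_computes_reduction:
  "poly_computes (\<lambda>(k, n, F). Branch (enc_rank k) (enc_3cnf n F))
     (\<lambda>(k, n, F). tree_size (enc_rank k) + tree_size (enc_3cnf n F) + length (rows k n))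
     (\<lambda>(k, n, F). enc_instance (reduction k n F))"
proof -
  let ?i = "\<lambda>(k, n, F). Branch (enc_rank k) (enc_3cnf n F)"
  let ?m = "\<lambda>(k, n, F). tree_size (enc_rank k) + tree_size (enc_3cnf n F) + length (rows k n)"
  let ?k = "\<lambda>a. fst a" let ?n = "\<lambda>a. fst (snd a)" let ?F = "\<lambda>a. snd (snd a)"
  let ?rs = "\<lambda>a. rows (?k a) (?n a)"
  have i: "poly_computes ?i ?m ?i"
    by (rule poly_computes_id, rule poly_bounded_mono[OF poly_bounded_Suc[OF poly_bounded_self]]) auto
  note l = poly_computes_left[OF i] and r = poly_computes_right[OF i]
  have k: "poly_computes ?i ?m (\<lambda>a. enc_nat (?k a))"
    by (rule poly_computes_cong[OF poly_computes_left[OF l]]) (auto simp: enc_rank_def)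
  have zs: "poly_computes ?i ?m (\<lambda>a. enc_list enc_nat [2..<?k a + 3])"
    by (rule poly_computes_cong[OF poly_computes_left[OF poly_computes_right[OF l]]]) (auto simp: enc_rank_def)
  have r0: "poly_computes ?i ?m (\<lambda>a. enc_list enc_row (init_rows (?k a)))"
    by (rule poly_computes_cong[OF poly_computes_right[OF poly_computes_right[OF l]]]) (auto simp: enc_rank_def)
  have n: "poly_computes ?i ?m (\<lambda>a. enc_nat (?n a))"
    by (rule poly_computes_cong[OF poly_computes_left[OF r]]) (auto simp: enc_3cnf_def Let_def)
  have F: "poly_computes ?i ?m (\<lambda>a. enc_list enc_clause (?F a))"
    by (rule poly_computes_cong[OF poly_computes_right[OF r]]) (auto simp: enc_3cnf_def Let_def)
  have rs: "poly_computes ?i ?m (\<lambda>a. enc_list enc_row (?rs a))"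
    by (rule poly_computes_rows[OF k n r0], rule poly_bounded_mono[OF poly_bounded_self]) auto
  note ix = poly_computes_index_rows[OF rs]
  have u: "poly_computes ?i ?m (\<lambda>a. enc_nat (length (?rs a)))"
    by (rule poly_computes_cong[OF poly_computes_left[OF ix]]) (simp add: fold_index_row)
  have "poly_computes ?i ?m (\<lambda>a. enc_list enc_row (snd (fold index_row (?rs a) (0, []))))"
    by (rule poly_computes_cong[OF poly_computes_right[OF ix]]) (simp add: fold_index_row)
  note cs = poly_computes_columns[OF n this]
  have rk: "poly_computes ?i ?m (\<lambda>a. enc_nat (Suc (?k a)))"
    unfolding enc_nat.simps by (intro poly_computes_intros k)
  have "poly_computes ?i ?m (\<lambda>a. enc_list id [enc_nat (Suc (?k a)), enc_fo (learn_fo [2..<?k a + 3] (?F a)),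
     enc_list enc_nat [0], enc_list enc_nat [1], enc_list enc_nat (replicate (?n a) 1), enc_nat (length (?rs a)),
     enc_list (enc_list enc_tuple) (columns (?n a) (snd (fold index_row (?rs a) (0, [])))),
     enc_list (enc_pair enc_tuple enc_bool) [([0], True)]])"
    unfolding enc_list.simps id_apply
    by (intro poly_computes_intros poly_computes_learn_fo rk zs F poly_computes_vocab n u cs)
  then show ?thesis
    by (rule poly_computes_cong) (auto simp: enc_instance_def reduction_def)
qed

subsection \<open>Correctness of the reduction\<close>

lemma sat_fold_Ex:
  "sat B \<sigma> (fold Ex zs \<phi>) \<longleftrightarrow>
    (\<exists>\<rho>. (\<forall>z \<in> set zs. \<rho> z \<in> universe B) \<and> sat B (\<lambda>z. if z \<in> set zs then \<rho> z else \<sigma> z) \<phi>)"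
proof (induction zs arbitrary: \<phi>)
  case (Cons z zs)
  \<comment> \<open>\<open>fold\<close> makes the head \<open>z\<close> the innermost quantifier, so
    its witness overrides the others.\<close>
  have "sat B \<sigma> (fold Ex (z # zs) \<phi>) \<longleftrightarrow> (\<exists>\<rho>. (\<forall>z \<in> set zs. \<rho> z \<in> universe B) \<and>
     (\<exists>a \<in> universe B. sat B ((\<lambda>z. if z \<in> set zs then \<rho> z else \<sigma> z)(z := a)) \<phi>))"
    using Cons by simp
  also have "\<dots> \<longleftrightarrow> (\<exists>\<rho>. (\<forall>y \<in> set (z # zs). \<rho> y \<in> universe B) \<and>
     sat B (\<lambda>y. if y \<in> set (z # zs) then \<rho> y else \<sigma> y) \<phi>)" (is "?L \<longleftrightarrow> ?R")
  proof
    assume ?L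
    then obtain \<rho> a where *: "\<forall>z \<in> set zs. \<rho> z \<in> universe B" "a \<in> universe B"
      "sat B ((\<lambda>z. if z \<in> set zs then \<rho> z else \<sigma> z)(z := a)) \<phi>" by blast
    have "(\<lambda>z. if z \<in> set zs then \<rho> z else \<sigma> z)(z := a) =
       (\<lambda>y. if y \<in> set (z # zs) then (\<rho>(z := a)) y else \<sigma> y)" by auto
    with * show ?R by (intro exI[of _ "\<rho>(z := a)"]) auto
  next
    assume ?R
    then obtain \<rho> where *: "\<forall>y \<in> set (z # zs). \<rho> y \<in> universe B"
      "sat B (\<lambda>y. if y \<in> set (z # zs) then \<rho> y else \<sigma> y) \<phi>" by blast
    have "(\<lambda>y. if y \<in> set (z # zs) then \<rho> y else \<sigma> y) =
       (\<lambda>y. if y \<in> set zs then \<rho> y else \<sigma> y)(z := \<rho> z)" by auto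
    with * show ?L by (metis list.set_intros(1,2))
  qed
  finally show ?case .
qed simp

lemma sat_var_fo: "sat B \<sigma> (var_fo zs v) \<longleftrightarrow> (\<exists>z \<in> set zs. [\<sigma> z] \<in> interp B v)"
proof -
  have "sat B \<sigma> (fold (\<lambda>z \<phi>. Disj (Rel v [z]) \<phi>) zs \<phi>) \<longleftrightarrow> (\<exists>z \<in> set zs. [\<sigma> z] \<in> interp B v) \<or> sat B \<sigma> \<phi>" for \<phi>
    by (induction zs arbitrary: \<phi>) auto
  then show ?thesis by (simp add: var_fo_def)
qed

lemma sat_lit_fo: "sat B \<sigma> (lit_fo zs l) \<longleftrightarrow> (\<exists>z \<in> set zs. [\<sigma> z] \<in> interp B (fst l)) = snd l"
  by (simp add: lit_fo_def sat_var_fo)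

lemma sat_cnf_fo:
  "sat B \<sigma> (cnf_fo zs F) \<longleftrightarrow>
     (\<forall>C \<in> set F. \<exists>l \<in> clause_lits C. (\<exists>z \<in> set zs. [\<sigma> z] \<in> interp B (fst l)) = snd l)"
proof -
  have "sat B \<sigma> (fold (\<lambda>C \<phi>. Conj (clause_fo zs C) \<phi>) F \<phi>) \<longleftrightarrow> (\<forall>C \<in> set F. sat B \<sigma> (clause_fo zs C)) \<and> sat B \<sigma> \<phi>" for \<phi>
    by (induction F arbitrary: \<phi>) auto
  moreover have "sat B \<sigma> (clause_fo zs C) \<longleftrightarrow> (\<exists>l \<in> clause_lits C. (\<exists>z \<in> set zs. [\<sigma> z] \<in> interp B (fst l)) = snd l)" for C
    by (cases C) (simp add: clause_fo_def sat_lit_fo)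
  ultimately show ?thesis by (simp add: cnf_fo_def)
qed

text \<open>The right-hand side is free of \<sigma>: although variable 0 is formally free, the
  formula behaves as a sentence.\<close>

lemma sat_sat_fo:
  "sat B \<sigma> (sat_fo zs F) \<longleftrightarrow> (\<exists>\<rho>. (\<forall>z \<in> set zs. \<rho> z \<in> universe B) \<and>
     (\<forall>C \<in> set F. \<exists>l \<in> clause_lits C. (\<exists>z \<in> set zs. [\<rho> z] \<in> interp B (fst l)) = snd l))"
  by (simp add: sat_fo_def sat_fold_Ex sat_cnf_fo)

section \<open>Quantifier rank, free variables and well-formedness\<close>

lemma syntax_var_fo:
  "qrank (var_fo zs v) = 0" "free_vars (var_fo zs v) \<subseteq> insert 0 (set zs)"
  "v < n \<Longrightarrow> wf_fo (replicate n 1) (var_fo zs v)"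
proof -
  let ?f = "\<lambda>\<phi>. fold (\<lambda>z \<phi>. Disj (Rel v [z]) \<phi>) zs \<phi>"
  have "qrank (?f \<phi>) = qrank \<phi>" "free_vars (?f \<phi>) = set zs \<union> free_vars \<phi>" for \<phi>
    by (induction zs arbitrary: \<phi>) auto
  then show "qrank (var_fo zs v) = 0" "free_vars (var_fo zs v) \<subseteq> insert 0 (set zs)"
    by (auto simp: var_fo_def)
  assume "v < n"
  then have "wf_fo (replicate n 1) (?f \<phi>) = wf_fo (replicate n 1) \<phi>" for \<phi>
    by (induction zs arbitrary: \<phi>) auto
  then show "wf_fo (replicate n 1) (var_fo zs v)" by (simp add: var_fo_def)
qed

lemma syntax_cnf_fo:
  "qrank (cnf_fo zs F) = 0" "free_vars (cnf_fo zs F) \<subseteq> insert 0 (set zs)"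
  "is_3cnf n F \<Longrightarrow> wf_fo (replicate n 1) (cnf_fo zs F)"
proof -
  let ?f = "\<lambda>\<phi>. fold (\<lambda>C \<phi>. Conj (clause_fo zs C) \<phi>) F \<phi>"
  have C: "qrank (clause_fo zs C) = 0" "free_vars (clause_fo zs C) \<subseteq> insert 0 (set zs)" for C
    using syntax_var_fo(2) by (auto simp: clause_fo_def lit_fo_def syntax_var_fo(1))
  then have "qrank (?f \<phi>) = qrank \<phi>" for \<phi>
    by (induction F arbitrary: \<phi>) auto
  then show "qrank (cnf_fo zs F) = 0" by (simp add: cnf_fo_def)
  have "free_vars (?f \<phi>) \<subseteq> insert 0 (set zs \<union> free_vars \<phi>)" for \<phi>
  proof (induction F arbitrary: \<phi>)
    case (Cons D F)
    show ?case using Cons[of "Conj (clause_fo zs D) \<phi>"] C(2)[of D] by auto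
  qed auto
  from this[of "Eq 0 0"] show "free_vars (cnf_fo zs F) \<subseteq> insert 0 (set zs)" by (simp add: cnf_fo_def)
  assume "is_3cnf n F"
  then have "\<forall>C \<in> set F. wf_fo (replicate n 1) (clause_fo zs C)"
  proof (intro ballI)
    fix C assume "C \<in> set F"
    moreover obtain a b c where "C = (a, b, c)" by (cases C)
    ultimately have "wf_fo (replicate n 1) (var_fo zs (fst l))" if "l \<in> {a, b, c}" for l
      using \<open>is_3cnf n F\<close> that by (intro syntax_var_fo(3)) (auto simp: is_3cnf_def)
    then show "wf_fo (replicate n 1) (clause_fo zs C)"
      by (auto simp: \<open>C = (a, b, c)\<close> clause_fo_def lit_fo_def)
  qed
  then have "wf_fo (replicate n 1) (?f \<phi>) = wf_fo (replicate n 1) \<phi>" for \<phi>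
    by (induction F arbitrary: \<phi>) auto
  then show "wf_fo (replicate n 1) (cnf_fo zs F)" by (simp add: cnf_fo_def)
qed

lemma syntax_fold_Ex:
  "qrank (fold Ex zs \<phi>) = length zs + qrank \<phi>" "free_vars (fold Ex zs \<phi>) = free_vars \<phi> - set zs"
  "wf_fo \<tau> (fold Ex zs \<phi>) = wf_fo \<tau> \<phi>"
  by (induction zs arbitrary: \<phi>) auto

lemma syntax_learn_fo:
  "qrank (learn_fo zs F) = length zs" "free_vars (learn_fo zs F) \<subseteq> {0, 1}"
  "is_3cnf n F \<Longrightarrow> wf_fo (replicate n 1) (learn_fo zs F)"
proof -
  show "qrank (learn_fo zs F) = length zs"
    by (simp add: learn_fo_def sat_fo_def syntax_fold_Ex syntax_cnf_fo)
  have "free_vars (sat_fo zs F) \<subseteq> {0}"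
    using syntax_cnf_fo(2)[of zs F] by (auto simp: sat_fo_def syntax_fold_Ex)
  then show "free_vars (learn_fo zs F) \<subseteq> {0, 1}" by (auto simp: learn_fo_def)
  show "is_3cnf n F \<Longrightarrow> wf_fo (replicate n 1) (learn_fo zs F)"
    using syntax_cnf_fo(3)[of n F zs] by (simp add: learn_fo_def sat_fo_def syntax_fold_Ex)
qed

section \<open>The relations of the structure and covering by rows\<close>

text \<open>Loop invariant of the transposition. It speaks of sets because each pass reverses the
  order of the rows; the position \<open>j - 1 - u\<close> reflects that tables are
  prepended.\<close>

lemma split_columns:
  defines "s \<equiv> \<lambda>j rs. (split_column ^^ j) (rs, [])"
  shows "set (fst (s j rs)) = (\<lambda>r. (fst r, drop j (snd r))) ` set rs \<and> length (snd (s j rs)) = j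
    \<and> (\<forall>u < j. set (snd (s j rs) ! u) = (\<lambda>r. [fst r]) ` {r \<in> set rs. j - 1 - u < length (snd r) \<and> snd r ! (j - 1 - u)})"
proof (induction j)
  case (Suc j)
  have e: "s (Suc j) rs = split_column (s j rs)" by (simp add: s_def)
  have "set (snd (s (Suc j) rs) ! u) = (\<lambda>r. [fst r]) ` {r \<in> set rs. j - u < length (snd r) \<and> snd r ! (j - u)}"
    if "u < Suc j" for u
  proof (cases u)
    case 0
    have h: "drop j w \<noteq> [] \<and> hd (drop j w) \<longleftrightarrow> j < length w \<and> w ! j" for w :: "bool list"
      by (auto simp: hd_drop_conv_nth)
    have "set (snd (s (Suc j) rs) ! 0) =
       (\<lambda>r. [fst r]) ` {r \<in> (\<lambda>r. (fst r, drop j (snd r))) ` set rs. snd r \<noteq> [] \<and> hd (snd r)}"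
      using Suc by (simp add: e split_column_eq)
    also have "\<dots> = (\<lambda>r. [fst r]) ` (\<lambda>r. (fst r, drop j (snd r))) `
       {r \<in> set rs. drop j (snd r) \<noteq> [] \<and> hd (drop j (snd r))}"
      by (simp only: Compr_image_eq snd_conv)
    also have "\<dots> = (\<lambda>r. [fst r]) ` {r \<in> set rs. j < length (snd r) \<and> snd r ! j}"
      by (simp only: h image_image fst_conv)
    finally show ?thesis using 0 by simp
  next
    case (Suc u')
    then have "u' < j" "j - 1 - u' = j - u" using that by auto
    moreover have "snd (s (Suc j) rs) ! u = snd (s j rs) ! u'" using Suc by (simp add: e split_column_eq)
    ultimately show ?thesis using Suc.IH by simp
  qed
  moreover have "set (fst (s (Suc j) rs)) = (\<lambda>r. (fst r, drop (Suc j) (snd r))) ` set rs"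
    using Suc by (simp add: e split_column_eq image_image drop_Suc tl_drop)
  moreover have "length (snd (s (Suc j) rs)) = Suc j" using Suc by (simp add: e split_column_eq)
  ultimately show ?case by simp
qed (auto simp: s_def)

text \<open>Every set of variables is a union of one element per block. In each round one of the
  chosen rows has counter 0; it takes the new bit, while the others take \<open>False\<close>, which
  does not affect the union.\<close>

lemma rows_cover:
  "length w = n \<Longrightarrow> \<exists>g. (\<forall>c \<le> k. (c, g c) \<in> set (rows k n)) \<and> (\<forall>j < n. w ! j \<longleftrightarrow> (\<exists>c \<le> k. g c ! j))"
proof (induction n arbitrary: w)
  case 0
  then show ?case by (intro exI[of _ "\<lambda>_. []"]) (auto simp: rows_0 init_rows_def)
next
  case (Suc n)
  then obtain b w' where w: "w = b # w'" "length w' = n" by (auto simp: length_Suc_conv)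
  obtain g where g: "\<forall>c \<le> k. (c, g c) \<in> set (rows k n)" "\<forall>j < n. w' ! j \<longleftrightarrow> (\<exists>c \<le> k. g c ! j)"
    using Suc.IH[OF w(2)] by blast
  \<comment> \<open>Rows are indexed by their current counter: counter \<open>k\<close> after the
    round means counter 0 and a choice before it, any other \<open>c\<close> was
    \<open>Suc c\<close>.\<close>
  define h where "h c = (if c = k then b # g 0 else False # g (Suc c))" for c
  have "(c, h c) \<in> set (rows k (Suc n))" if "c \<le> k" for c
  proof (cases "c = k")
    case True
    have "(0, g 0) \<in> set (rows k n)" using g(1) by simp
    then show ?thesis using True
      by (auto simp: rows_Suc set_fold_expand_row h_def expand_row_def intro!: bexI[of _ "(0, g 0)"])
  next
    case False
    then have "(Suc c, g (Suc c)) \<in> set (rows k n)" using g(1) that by simp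
    then show ?thesis using False
      by (auto simp: rows_Suc set_fold_expand_row h_def expand_row_def intro!: bexI[of _ "(Suc c, g (Suc c))"])
  qed
  moreover have "w ! j \<longleftrightarrow> (\<exists>c \<le> k. h c ! j)" if "j < Suc n" for j
  proof (cases j)
    case 0
    then show ?thesis by (auto simp: w h_def)
  next
    case (Suc i)
    \<comment> \<open>Older bits are merely re-indexed: 0 moves to \<open>k\<close>, and any other
      \<open>c\<close> to \<open>c - 1\<close>.\<close>
    have "(\<exists>c \<le> k. g c ! i) \<longleftrightarrow> (\<exists>c \<le> k. h c ! j)"
    proof
      assume "\<exists>c \<le> k. g c ! i"
      then obtain c where c: "c \<le> k" "g c ! i" by blast
      show "\<exists>c \<le> k. h c ! j"
        using c Suc by (cases c) (auto simp: h_def intro: exI[of _ k] exI[of _ "c - 1"])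
    next
      assume "\<exists>c \<le> k. h c ! j"
      then obtain c where c: "c \<le> k" "h c ! j" by blast
      show "\<exists>c \<le> k. g c ! i"
        by (rule exI[of _ "if c = k then 0 else Suc c"]) (use c Suc in \<open>auto simp: h_def split: if_splits\<close>)
    qed
    then show ?thesis using g(2) Suc that by (simp add: w)
  qed
  ultimately show ?case by blast
qed

lemma set_index_rows:
  "set (snd (fold index_row rs (0, []))) = {(j, snd (rs ! j)) | j. j < length rs}"
proof -
  have "zip [0..<length rs] (map snd rs) = map (\<lambda>j. (j, snd (rs ! j))) [0..<length rs]"
    by (rule nth_equalityI) auto
  then show ?thesis by (auto simp: fold_index_row)
qed

lemma interp_reduction:
  assumes "v < n" "i < length (rows k n)"
  shows "[i] \<in> interp (background (reduction k n F)) v \<longleftrightarrow> snd (rows k n ! i) ! (n - 1 - v)"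
proof -
  let ?rs = "rows k n"
  let ?ix = "snd (fold index_row ?rs (0, []))"
  note ix = set_index_rows[of ?rs]
  note c = split_columns[of n ?ix, folded columns_def]
  have "[i] \<in> interp (background (reduction k n F)) v \<longleftrightarrow> [i] \<in> set (columns n ?ix ! v)"
    using c assms by (simp add: background_def reduction_def)
  also have "\<dots> \<longleftrightarrow> (\<exists>r \<in> set ?ix. i = fst r \<and> n - 1 - v < length (snd r) \<and> snd r ! (n - 1 - v))"
    using c assms(1) by auto
  also have "\<dots> \<longleftrightarrow> snd (?rs ! i) ! (n - 1 - v)"
    using assms rows_bounds[OF nth_mem[OF assms(2)]] unfolding ix by auto
  finally show ?thesis .
qed

lemma tables_reduction:
  "length (tables (reduction k n F)) = n"
  "v < n \<Longrightarrow> set (tables (reduction k n F) ! v) \<subseteq> tuples (background (reduction k n F)) 1"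
proof -
  let ?rs = "rows k n"
  let ?ix = "snd (fold index_row ?rs (0, []))"
  note ix = set_index_rows[of ?rs]
  note c = split_columns[of n ?ix, folded columns_def]
  show "length (tables (reduction k n F)) = n" using c by (simp add: reduction_def)
  assume "v < n"
  then show "set (tables (reduction k n F) ! v) \<subseteq> tuples (background (reduction k n F)) 1"
    using c ix by (auto simp: reduction_def tuples_def background_def)
qed

text \<open>A satisfying assignment is covered by one row per block, and these rows are the
  witnesses. Conversely, whatever elements are chosen, the union of their sets of variables is an
  assignment.\<close>

lemma sat_fo_reduction:
  assumes "is_3cnf n F"
  shows "sat (background (reduction k n F)) \<sigma> (sat_fo [2..<k + 3] F) \<longleftrightarrow> satisfiable F"
proof -
  let ?B = "background (reduction k n F)"
  let ?zs = "[2..<k + 3]"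
  have U: "universe ?B = {..<length (rows k n)}" by (simp add: background_def reduction_def)
  have "(\<exists>\<rho>. (\<forall>z \<in> set ?zs. \<rho> z \<in> universe ?B) \<and>
     (\<forall>C \<in> set F. \<exists>l \<in> clause_lits C. (\<exists>z \<in> set ?zs. [\<rho> z] \<in> interp ?B (fst l)) = snd l))"
    if sat: "satisfiable F"
  proof -
    obtain \<alpha> where \<alpha>: "\<forall>C \<in> set F. \<exists>l \<in> clause_lits C. \<alpha> (fst l) = snd l"
      using sat unfolding satisfiable_def by blast
    \<comment> \<open>Reversed, because rows list the last variable first.\<close>
    define w where "w = map (\<lambda>j. \<alpha> (n - 1 - j)) [0..<n]"
    obtain g where g: "\<forall>c \<le> k. (c, g c) \<in> set (rows k n)" "\<forall>j < n. w ! j \<longleftrightarrow> (\<exists>c \<le> k. g c ! j)"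
      using rows_cover[of w n k] by (auto simp: w_def)
    have "\<forall>c. \<exists>i. c \<le> k \<longrightarrow> i < length (rows k n) \<and> rows k n ! i = (c, g c)"
      using g(1) by (auto simp: in_set_conv_nth)
    then obtain ind where ind: "\<And>c. c \<le> k \<Longrightarrow> ind c < length (rows k n) \<and> rows k n ! ind c = (c, g c)"
      by metis
    \<comment> \<open>Quantified variables start at 2, blocks at 0.\<close>
    define \<rho> where "\<rho> z = ind (z - 2)" for z
    have "(\<exists>z \<in> set ?zs. [\<rho> z] \<in> interp ?B v) = \<alpha> v" if v: "v < n" for v
    proof -
      have "(\<exists>z \<in> set ?zs. [\<rho> z] \<in> interp ?B v) \<longleftrightarrow> (\<exists>c \<le> k. [ind c] \<in> interp ?B v)"
      proof
        assume "\<exists>c \<le> k. [ind c] \<in> interp ?B v"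
        then obtain c where "c \<le> k" "[ind c] \<in> interp ?B v" by blast
        then show "\<exists>z \<in> set ?zs. [\<rho> z] \<in> interp ?B v"
          by (intro bexI[of _ "c + 2"]) (auto simp: \<rho>_def)
      next
        assume "\<exists>z \<in> set ?zs. [\<rho> z] \<in> interp ?B v"
        then obtain z where "z \<in> set ?zs" "[\<rho> z] \<in> interp ?B v" by blast
        then show "\<exists>c \<le> k. [ind c] \<in> interp ?B v"
          by (intro exI[of _ "z - 2"]) (auto simp: \<rho>_def)
      qed
      also have "\<dots> \<longleftrightarrow> (\<exists>c \<le> k. g c ! (n - 1 - v))"
        using ind interp_reduction[OF v] by (metis snd_conv)
      also have "\<dots> \<longleftrightarrow> w ! (n - 1 - v)" using g(2) v by simp
      also have "\<dots> = \<alpha> v" using v by (simp add: w_def)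
      finally show ?thesis .
    qed
    then have "(\<exists>z \<in> set ?zs. [\<rho> z] \<in> interp ?B (fst l)) = \<alpha> (fst l)" if "C \<in> set F" "l \<in> clause_lits C" for C l
      using assms that unfolding is_3cnf_def by blast
    then have "\<forall>C \<in> set F. \<exists>l \<in> clause_lits C. (\<exists>z \<in> set ?zs. [\<rho> z] \<in> interp ?B (fst l)) = snd l"
      using \<alpha> by metis
    moreover have "\<forall>z \<in> set ?zs. \<rho> z \<in> universe ?B"
      using ind by (auto simp: U \<rho>_def)
    ultimately show ?thesis by blast
  qed
  moreover have "satisfiable F" if s: "sat ?B \<sigma> (sat_fo ?zs F)"
  proof -
    obtain \<rho> where "\<forall>C \<in> set F. \<exists>l \<in> clause_lits C. (\<exists>z \<in> set ?zs. [\<rho> z] \<in> interp ?B (fst l)) = snd l"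
      using s unfolding sat_sat_fo by blast
    then show ?thesis unfolding satisfiable_def
      by (rule exI[of _ "\<lambda>v. \<exists>z \<in> set ?zs. [\<rho> z] \<in> interp ?B v"])
  qed
  ultimately show ?thesis unfolding sat_sat_fo by blast
qed

text \<open>On the example 0 the hypothesis with parameter \<open>y\<close> says that
  \<open>0 = y\<close> holds iff \<open>F\<close> is satisfiable, and the label is true. So every
  correct answer of a learner decides satisfiability.\<close>

lemma consistent_params_reduction:
  assumes "is_3cnf n F"
  shows "consistent_params (reduction k n F) v \<longleftrightarrow>
     (\<exists>y < length (rows k n). v = [y] \<and> (y = 0 \<longleftrightarrow> satisfiable F))"
proof -
  let ?B = "background (reduction k n F)"
  have sel: "formula (reduction k n F) = learn_fo [2..<k + 3] F" "xvars (reduction k n F) = [0]"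
    "yvars (reduction k n F) = [1]" "training (reduction k n F) = [([0], True)]"
    by (simp_all add: reduction_def)
  have hyp: "hypothesis ?B (learn_fo [2..<k + 3] F) [0] [1] [y] [0] \<longleftrightarrow> (y = 0 \<longleftrightarrow> satisfiable F)" for y
    by (simp add: hypothesis_def learn_fo_def sat_fo_reduction[OF assms] del: upt_Suc) blast
  have "v \<in> tuples ?B (length [1 :: nat]) \<longleftrightarrow> (\<exists>y < length (rows k n). v = [y])"
    by (auto simp: tuples_def background_def reduction_def length_Suc_conv)
  then show ?thesis
    unfolding consistent_params_def consistent_def sel using hyp by fastforce
qed

lemma length_rows_ge: "Suc k \<le> length (rows k n)"
  using length_rows_mono[of 0 n k] by (simp add: rows_0 init_rows_def)

lemma learnable_reduction:
  assumes "is_3cnf n F" "1 \<le> k"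
  shows "learnable_instance (reduction k n F)"
proof -
  \<comment> \<open>Two elements are needed: the unsatisfiable case calls for a parameter other than
    0.\<close>
  have N: "2 \<le> length (rows k n)" using length_rows_ge[of k n] assms(2) by simp
  have "consistent_params (reduction k n F) [if satisfiable F then 0 else 1]"
    using N by (auto simp: consistent_params_reduction[OF assms(1)])
  moreover have "0 < usize (reduction k n F)" using N by (auto simp: reduction_def)
  moreover have "[0] \<in> tuples (background (reduction k n F)) 1"
    using N by (auto simp: tuples_def background_def reduction_def)
  ultimately show ?thesis
    unfolding learnable_instance_def
    using tables_reduction[where k = k and n = n and F = F] syntax_learn_fo(2)[of "[2..<k + 3]" F]
      syntax_learn_fo(3)[OF assms(1), of "[2..<k + 3]"]
    by (auto simp: reduction_def syntax_learn_fo)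
qed

section \<open>Sizes of the universe and of the input\<close>

text \<open>The weights are chosen so that every round multiplies their sum by \<open>2 powr (1 / Suc k)\<close>.\<close>

lemma sum_rows_weights:
  "(\<Sum>r \<leftarrow> rows k n. 2 powr (- real (fst r) / real (Suc k))) =
    (\<Sum>r \<leftarrow> init_rows k. 2 powr (- real (fst r) / real (Suc k))) * 2 powr (real n / real (Suc k))"
proof (induction n)
  case (Suc n)
  let ?W = "\<lambda>rs :: (nat \<times> bool list) list. \<Sum>r \<leftarrow> rs. 2 powr (- real (fst r) / real (Suc k))"
  \<comment> \<open>Lowering a counter multiplies the weight by the growth factor. A row of weight 1
    with counter 0 is replaced by two rows with counter \<open>k\<close>, each weighing half of that
    factor.\<close>
  have e: "?W (expand_row k r a) = 2 powr (- real (fst r) / real (Suc k)) * 2 powr (1 / real (Suc k)) + ?W a" for r a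
  proof (cases "fst r = 0")
    case True
    have "- real k / real (Suc k) = 1 / real (Suc k) - 1" by (simp add: field_simps)
    then have "2 powr (- real k / real (Suc k)) = 2 powr (1 / real (Suc k)) / 2"
      by (simp add: powr_diff)
    then show ?thesis using True by (simp add: expand_row_def)
  next
    case False
    have "- real (fst r - 1) / real (Suc k) = - real (fst r) / real (Suc k) + 1 / real (Suc k)"
      using False by (simp add: field_simps of_nat_diff)
    then have "2 powr (- real (fst r - 1) / real (Suc k)) = 2 powr (- real (fst r) / real (Suc k)) * 2 powr (1 / real (Suc k))"
      by (simp only: powr_add)
    moreover have "expand_row k r a = (fst r - 1, False # snd r) # a"
      using False by (simp add: expand_row_def)
    ultimately show ?thesis by (simp only: list.map sum_list.Cons fst_conv)
  qed
  have "?W (fold (expand_row k) rs a) = ?W rs * 2 powr (1 / real (Suc k)) + ?W a" for rs a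
  proof (induction rs arbitrary: a)
    case (Cons r rs)
    show ?case
      by (simp only: fold_simps Cons.IH e list.map sum_list.Cons) (simp only: algebra_simps)
  qed simp
  then have "?W (rows k (Suc n)) = ?W (rows k n) * 2 powr (1 / real (Suc k))"
    by (simp add: rows_Suc)
  moreover have "real (Suc n) / real (Suc k) = real n / real (Suc k) + 1 / real (Suc k)"
    by (simp add: field_simps)
  ultimately show ?case using Suc by (simp only: powr_add mult.assoc)
qed (simp add: rows_0)

text \<open>Counters never exceed \<open>k\<close>, so a row weighs at least 1/2 and there are at
  most twice as many rows as the total weight. Initially there are \<open>Suc k\<close> rows of
  weight at most 1.\<close>

lemma length_rows_le:
  "real (length (rows k n)) \<le> 2 * real (Suc k) * 2 powr (real n / real (Suc k))"
proof -
  let ?w = "\<lambda>r :: nat \<times> bool list. 2 powr (- real (fst r) / real (Suc k))"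
  have "1 \<le> 2 * ?w r" if "r \<in> set (rows k n)" for r
  proof -
    have "2 powr (-1) \<le> ?w r"
      using rows_bounds[OF that] by (intro powr_mono) (auto simp: field_simps)
    then show ?thesis by (simp add: powr_minus)
  qed
  then have "(\<Sum>r \<leftarrow> rows k n. 1) \<le> (\<Sum>r \<leftarrow> rows k n. 2 * ?w r)"
    by (rule sum_list_mono)
  then have len: "real (length (rows k n)) \<le> 2 * (\<Sum>r \<leftarrow> rows k n. ?w r)"
    by (simp add: sum_list_const_mult sum_list_triv)
  have "(\<Sum>r \<leftarrow> init_rows k. ?w r) \<le> (\<Sum>r \<leftarrow> init_rows k. (1 :: real))"
  proof (rule sum_list_mono)
    fix r :: "nat \<times> bool list"
    have "?w r \<le> 2 powr 0" by (intro powr_mono) (auto simp: field_simps)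
    then show "?w r \<le> 1" by simp
  qed
  moreover have "(\<Sum>r \<leftarrow> init_rows k. (1 :: real)) = real (Suc k)"
    by (simp only: sum_list_triv) (simp add: init_rows_def)
  ultimately have "(\<Sum>r \<leftarrow> init_rows k. ?w r) * 2 powr (real n / real (Suc k)) \<le> real (Suc k) * 2 powr (real n / real (Suc k))"
    by (intro mult_right_mono) auto
  then show ?thesis using len unfolding sum_rows_weights by linarith
qed

text \<open>Clauses are distinct and there are \<open>2 * n\<close> literals, so there are at most
  \<open>8 * n ^ 3\<close> clauses, each of linear size.\<close>

lemma tree_size_3cnf:
  assumes "is_3cnf n F"
  shows "tree_size (enc_3cnf n F) \<le> 200 * Suc n ^ 4"
proof -
  have bool: "tree_size (enc_bool b) \<le> 3" for b by (cases b) auto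
  have p: "1 + 8 * m ^ 3 * (21 * m) = 1 + 168 * m ^ 4" for m :: nat
    using power_Suc2[of m 3] by simp
  let ?L = "{..<n} \<times> (UNIV :: bool set)"
  have "set F \<subseteq> ?L \<times> (?L \<times> ?L)"
  proof
    fix C assume C: "C \<in> set F"
    obtain a b c where "C = (a, b, c)" by (cases C)
    with C assms show "C \<in> ?L \<times> (?L \<times> ?L)" by (cases a; cases b; cases c) (auto simp: is_3cnf_def)
  qed
  then have "card (set F) \<le> card (?L \<times> (?L \<times> ?L))" by (intro card_mono) auto
  then have F: "length F \<le> 8 * n ^ 3"
    using assms by (simp add: is_3cnf_def distinct_card card_cartesian_product power3_eq_cube)
  have "tree_size (enc_list enc_clause F) \<le> 1 + length F * ((6 * n + 20) + 1)"
  proof (rule enc_list_size_le)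
    fix C assume C: "C \<in> set F"
    obtain a b c where C': "C = (a, b, c)" by (cases C)
    with C assms have "fst a < n" "fst b < n" "fst c < n" by (auto simp: is_3cnf_def)
    then show "tree_size (enc_clause C) \<le> 6 * n + 20"
      using bool[of "snd a"] bool[of "snd b"] bool[of "snd c"] by (simp add: C' enc_pair_eq)
  qed
  also have "\<dots> \<le> 1 + 8 * n ^ 3 * (6 * n + 21)"
    by (rule add_le_mono[OF le_refl], rule mult_le_mono) (use F in auto)
  also have "\<dots> \<le> 1 + 8 * Suc n ^ 3 * (21 * Suc n)"
    by (intro add_le_mono mult_le_mono power_mono) auto
  also have "\<dots> = 1 + 168 * Suc n ^ 4" by (rule p)
  finally have "tree_size (enc_list enc_clause F) \<le> 1 + 168 * Suc n ^ 4" .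
  moreover have "Suc n \<le> Suc n ^ 4" by (rule self_le_power) auto
  ultimately show ?thesis by (simp add: enc_3cnf_def Let_def)
qed

subsection \<open>Exponential growth rates\<close>

text \<open>Exponential rate up to a polynomial factor; under products the rates add. Nonnegativity
  is included so that bounds can be multiplied.\<close>

definition exp_bounded :: "real \<Rightarrow> (nat \<Rightarrow> real) \<Rightarrow> bool" where
  "exp_bounded \<gamma> u \<longleftrightarrow>
     (\<exists>K b. \<forall>n. 0 \<le> u n \<and> u n \<le> K * real (Suc n) ^ b * 2 powr (\<gamma> * real n))"

lemma exp_boundedI:
  assumes "\<And>n. 0 \<le> u n" "\<And>n. u n \<le> K * real (Suc n) ^ b * 2 powr (\<gamma> * real n)"
  shows "exp_bounded \<gamma> u"
  using assms unfolding exp_bounded_def by blast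

lemma exp_bounded_mono:
  assumes "exp_bounded \<gamma> u" "\<gamma> \<le> \<gamma>'"
  shows "exp_bounded \<gamma>' u"
proof -
  obtain K b where *: "\<And>n. 0 \<le> u n \<and> u n \<le> K * real (Suc n) ^ b * 2 powr (\<gamma> * real n)"
    using assms(1) unfolding exp_bounded_def by blast
  have "K \<ge> 0" using *[of 0] by simp
  then have "K * real (Suc n) ^ b * 2 powr (\<gamma> * real n) \<le> K * real (Suc n) ^ b * 2 powr (\<gamma>' * real n)" for n
    using assms(2) by (intro mult_left_mono powr_mono mult_right_mono) auto
  then show ?thesis using * by (intro exp_boundedI[of u K b]) (auto intro: order_trans)
qed

lemma exp_bounded_add:
  assumes "exp_bounded \<gamma> u" "exp_bounded \<gamma> v"
  shows "exp_bounded \<gamma> (\<lambda>n. u n + v n)"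
proof -
  obtain K b where 1: "\<And>n. 0 \<le> u n \<and> u n \<le> K * real (Suc n) ^ b * 2 powr (\<gamma> * real n)"
    using assms(1) unfolding exp_bounded_def by blast
  obtain K' b' where 2: "\<And>n. 0 \<le> v n \<and> v n \<le> K' * real (Suc n) ^ b' * 2 powr (\<gamma> * real n)"
    using assms(2) unfolding exp_bounded_def by blast
  have K: "K \<ge> 0" "K' \<ge> 0" using 1[of 0] 2[of 0] by auto
  have "u n + v n \<le> (K + K') * real (Suc n) ^ (b + b') * 2 powr (\<gamma> * real n)" for n
  proof -
    have "K * real (Suc n) ^ b \<le> K * real (Suc n) ^ (b + b')" "K' * real (Suc n) ^ b' \<le> K' * real (Suc n) ^ (b + b')"
      using K by (intro mult_left_mono power_increasing; simp)+
    then have "K * real (Suc n) ^ b * 2 powr (\<gamma> * real n) + K' * real (Suc n) ^ b' * 2 powr (\<gamma> * real n)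
      \<le> K * real (Suc n) ^ (b + b') * 2 powr (\<gamma> * real n) + K' * real (Suc n) ^ (b + b') * 2 powr (\<gamma> * real n)"
      by (intro add_mono mult_right_mono) auto
    then show ?thesis using 1[of n] 2[of n] by (simp only: distrib_right) linarith
  qed
  then show ?thesis using 1 2 by (intro exp_boundedI[of _ "K + K'" "b + b'"]) auto
qed

lemma exp_bounded_mult:
  assumes "exp_bounded \<gamma> u" "exp_bounded \<gamma>' v"
  shows "exp_bounded (\<gamma> + \<gamma>') (\<lambda>n. u n * v n)"
proof -
  obtain K b where 1: "\<And>n. 0 \<le> u n \<and> u n \<le> K * real (Suc n) ^ b * 2 powr (\<gamma> * real n)"
    using assms(1) unfolding exp_bounded_def by blast
  obtain K' b' where 2: "\<And>n. 0 \<le> v n \<and> v n \<le> K' * real (Suc n) ^ b' * 2 powr (\<gamma>' * real n)"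
    using assms(2) unfolding exp_bounded_def by blast
  have "u n * v n \<le> (K * K') * real (Suc n) ^ (b + b') * 2 powr ((\<gamma> + \<gamma>') * real n)" for n
  proof -
    have "u n * v n \<le> (K * real (Suc n) ^ b * 2 powr (\<gamma> * real n)) * (K' * real (Suc n) ^ b' * 2 powr (\<gamma>' * real n))"
      using 1[of n] 2[of n] by (intro mult_mono) auto
    moreover have "2 powr ((\<gamma> + \<gamma>') * real n) = 2 powr (\<gamma> * real n) * 2 powr (\<gamma>' * real n)"
      by (simp only: distrib_right powr_add)
    ultimately show ?thesis by (simp only: power_add mult_ac)
  qed
  then show ?thesis using 1 2 by (intro exp_boundedI[of _ "K * K'" "b + b'"]) auto
qed

lemma exp_bounded_const: "0 \<le> c \<Longrightarrow> exp_bounded 0 (\<lambda>_. c)"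
  by (rule exp_boundedI[of _ c 0]) auto

lemma exp_bounded_power: "exp_bounded \<gamma> u \<Longrightarrow> exp_bounded (real j * \<gamma>) (\<lambda>n. u n ^ j)"
proof (induction j)
  case 0
  show ?case using exp_bounded_const[of 1] by simp
next
  case (Suc j)
  have "exp_bounded (\<gamma> + real j * \<gamma>) (\<lambda>n. u n * u n ^ j)"
    using Suc by (intro exp_bounded_mult) auto
  then show ?case by (simp add: distrib_right)
qed

lemma Suc_le_exp:
  assumes "0 < (c :: real)"
  shows "real (Suc n) \<le> (1 + 1 / (c * ln 2)) * 2 powr (c * real n)"
proof -
  let ?z = "c * ln 2"
  have z: "0 < ?z" using assms by simp
  have e: "1 + ?z * real n \<le> 2 powr (c * real n)"
    using exp_ge_add_one_self[of "?z * real n"] by (simp add: powr_def mult_ac)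
  have "real (Suc n) \<le> (1 + 1 / ?z) * (1 + ?z * real n)"
    using z assms by (simp add: field_simps)
  also have "\<dots> \<le> (1 + 1 / ?z) * 2 powr (c * real n)"
    using z e by (intro mult_left_mono) auto
  finally show ?thesis .
qed

lemma exp_bounded_imp:
  assumes "exp_bounded \<gamma> u" "\<gamma> < \<epsilon>"
  shows "\<exists>K. \<forall>n. u n \<le> K * 2 powr (\<epsilon> * real n)"
proof -
  obtain K b where *: "\<And>n. 0 \<le> u n \<and> u n \<le> K * real (Suc n) ^ b * 2 powr (\<gamma> * real n)"
    using assms(1) unfolding exp_bounded_def by blast
  have K: "K \<ge> 0" using *[of 0] by simp
  \<comment> \<open>The slack between the two rates is shared out among \<open>Suc b\<close> linear
    factors, each of which is bounded by a multiple of \<open>2 powr (c * n)\<close>.\<close>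
  define c where "c = (\<epsilon> - \<gamma>) / real (Suc b)"
  have c: "c > 0" using assms(2) by (simp add: c_def)
  define A where "A = 1 + 1 / (c * ln 2)"
  have "u n \<le> K * A ^ Suc b * 2 powr (\<epsilon> * real n)" for n
  proof -
    have "real (Suc n) ^ b \<le> real (Suc n) ^ Suc b" by (intro power_increasing) auto
    also have "\<dots> \<le> (A * 2 powr (c * real n)) ^ Suc b"
      using Suc_le_exp[OF c, of n] unfolding A_def by (intro power_mono) auto
    also have "\<dots> = A ^ Suc b * 2 powr (real (Suc b) * (c * real n))"
      by (simp only: power_mult_distrib powr_realpow[symmetric] powr_powr powr_gt_zero mult_ac)
    also have "real (Suc b) * (c * real n) = (\<epsilon> - \<gamma>) * real n" by (simp add: c_def del: of_nat_Suc)
    finally have "K * real (Suc n) ^ b * 2 powr (\<gamma> * real n) \<le> K * (A ^ Suc b * 2 powr ((\<epsilon> - \<gamma>) * real n)) * 2 powr (\<gamma> * real n)"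
      using K by (intro mult_right_mono mult_left_mono) auto
    also have "\<dots> = K * A ^ Suc b * 2 powr ((\<epsilon> - \<gamma>) * real n + \<gamma> * real n)"
      by (simp only: powr_add mult_ac)
    also have "(\<epsilon> - \<gamma>) * real n + \<gamma> * real n = \<epsilon> * real n" by (simp add: algebra_simps)
    finally show ?thesis using *[of n] by linarith
  qed
  then show ?thesis by blast
qed

lemma exp_bounded_length_rows: "exp_bounded (1 / real (Suc k)) (\<lambda>n. real (length (rows k n)))"
  using length_rows_le by (intro exp_boundedI[of _ "2 * real (Suc k)" 0]) auto

text \<open>Here a sublinear exponent pays off: the universe has rate \<open>1 / Suc k\<close>, so a
  power of at most \<open>\<delta> * Suc k\<close> has rate \<delta>.\<close>

lemma exp_bounded_length_rows_powr:
  assumes "x \<le> \<delta> * real (Suc k)" "0 \<le> \<delta>"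
  shows "exp_bounded \<delta> (\<lambda>n. real (length (rows k n)) powr x)"
proof (rule exp_boundedI[where b = 0])
  fix n
  let ?y = "\<delta> * real (Suc k)"
  \<comment> \<open>\<open>x\<close> may be negative, so it is first raised to the nonnegative
    \<open>?y\<close>; monotonicity in the base applies only then.\<close>
  have "real (length (rows k n)) powr x \<le> real (length (rows k n)) powr ?y"
    using length_rows_ge[of k n] assms(1) by (intro powr_mono) auto
  also have "\<dots> \<le> (2 * real (Suc k) * 2 powr (real n / real (Suc k))) powr ?y"
    using length_rows_le assms by (intro powr_mono2) auto
  also have "\<dots> = (2 * real (Suc k)) powr ?y * 2 powr (\<delta> * real n)"
    by (simp add: powr_mult powr_powr mult.commute)
  finally show "real (length (rows k n)) powr x \<le> (2 * real (Suc k)) powr ?y * real (Suc n) ^ 0 * 2 powr (\<delta> * real n)"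
    by simp
qed simp

section \<open>Reading off the answer and refuting ETH\<close>

text \<open>The left subtree of an encoded one-tuple encodes its entry, and it is
  \<open>Leaf\<close> iff the entry is 0.\<close>

lemma poly_time_decide:
  "poly_time (\<lambda>x. x) (\<lambda>x. enc_bool (left x = Leaf))"
proof -
  have i: "poly_time (\<lambda>x. x) (\<lambda>x. x)" by (rule poly_computes_id) simp
  show ?thesis
    by (rule poly_computes_cong[OF poly_computes_If[OF poly_computes_left[OF i] poly_computes_const[of _ _ Leaf]
       poly_computes_const[of _ _ "Branch Leaf Leaf"]]]) auto
qed

lemma poly_computesD:
  assumes "poly_computes i m f"
  shows "\<exists>p c e. \<forall>a. \<exists>t \<le> c * Suc (m a) ^ e. outputs_in p (i a) t (f a)"
proof -
  obtain p T where p: "poly_bounded m T" "\<And>a. \<exists>t \<le> T a. outputs_in p (i a) t (f a)"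
    using assms unfolding poly_computes_def by blast
  obtain c e where "\<And>a. T a \<le> c * Suc (m a) ^ e" using p(1) unfolding poly_bounded_def by blast
  then show ?thesis using p(2) by (meson order_trans)
qed

theorem theorem5:
  assumes "ETH"
  shows "\<not> (\<exists>(p :: com) (f :: nat \<Rightarrow> real) (h :: nat \<Rightarrow> real) (d :: nat).
             h \<in> o(\<lambda>q. real q) \<and> learns_in_time p f h d)"
proof
  assume "\<exists>(p :: com) (f :: nat \<Rightarrow> real) (h :: nat \<Rightarrow> real) (d :: nat).
             h \<in> o(\<lambda>q. real q) \<and> learns_in_time p f h d"
  then obtain p f h d where h: "h \<in> o(\<lambda>q. real q)" and learn: "learns_in_time p f h d" by blast
  obtain \<epsilon> where \<epsilon>: "\<epsilon> > 0" "\<And>p. \<not> solves_3sat_in_exp p \<epsilon>"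
    using assms unfolding ETH_def by blast
  define m where "m k n F = tree_size (enc_rank k) + tree_size (enc_3cnf n F) + length (rows k n)" for k n F
  have "\<exists>p c e. \<forall>k n F. \<exists>t \<le> c * Suc (m k n F) ^ e.
      outputs_in p (Branch (enc_rank k) (enc_3cnf n F)) t (enc_instance (reduction k n F))"
    using poly_computesD[OF poly_computes_reduction] by (simp add: m_def)
  then obtain pr c1 e1 where pr: "\<And>k n F. \<exists>t \<le> c1 * Suc (m k n F) ^ e1.
      outputs_in pr (Branch (enc_rank k) (enc_3cnf n F)) t (enc_instance (reduction k n F))"
    by blast
  have "\<exists>c e. \<forall>k n F. tree_size (enc_instance (reduction k n F)) \<le> c * Suc (m k n F) ^ e"
    using poly_computes_size[OF poly_computes_reduction] unfolding poly_bounded_def m_def by auto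
  then obtain c2 e2 where size: "\<And>k n F. tree_size (enc_instance (reduction k n F)) \<le> c2 * Suc (m k n F) ^ e2"
    by blast
  obtain pd c4 e4 where pd: "\<And>x. \<exists>t \<le> c4 * Suc (tree_size x) ^ e4. outputs_in pd x t (enc_bool (left x = Leaf))"
    using poly_computesD[OF poly_time_decide] by blast

  \<comment> \<open>Collects the exponents with which the universe size enters the running time:
    from the reduction, from the input-length factor of the learner and from the final test.\<close>
  define E where "E = real e1 + real d * real e2 + real e4"
  have "\<forall>\<^sub>F q in at_top. norm (h q) \<le> \<epsilon> / 4 * norm (real q)"
    using landau_o.smallD[OF h, of "\<epsilon> / 4"] \<epsilon> by simp
  then obtain Q where Q: "\<And>q. q \<ge> Q \<Longrightarrow> \<bar>h q\<bar> \<le> \<epsilon> / 4 * real q"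
    unfolding eventually_at_top_linorder by auto
  \<comment> \<open>All exponents in \<open>E\<close> are fixed before \<open>k\<close> is chosen.
    Now \<open>Suc k\<close> is beyond the threshold for \<open>h\<close> and at least
    \<open>4 * E / \<epsilon>\<close>, and \<open>k \<ge> 1\<close>.\<close>
  define k where "k = Suc (max Q (nat \<lceil>4 * E / \<epsilon>\<rceil>))"
  have k1: "1 \<le> k" by (simp add: k_def)
  have hk: "h (Suc k) \<le> \<epsilon> / 4 * real (Suc k)"
  proof -
    have "Q \<le> Suc k" by (simp add: k_def)
    from Q[OF this] show ?thesis by linarith
  qed
  have "4 * E / \<epsilon> \<le> real (Suc k)" unfolding k_def by linarith
  then have Ek: "E * (1 / real (Suc k)) \<le> \<epsilon> / 4" using \<epsilon> by (simp add: field_simps)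

  \<comment> \<open>With \<open>k\<close> fixed, its data are hard-wired into the program.\<close>
  have "poly_time (\<lambda>x. x) (\<lambda>x. Branch (enc_rank k) x)"
    by (intro poly_computes_intros poly_computes_id) simp
  then obtain pk c3 e3 where pk: "\<And>x. \<exists>t \<le> c3 * Suc (tree_size x) ^ e3. outputs_in pk x t (Branch (enc_rank k) x)"
    using poly_computesD by blast
  obtain p1 a1 where p1: "\<And>x t y t' z. outputs_in pk x t y \<Longrightarrow> outputs_in pr y t' z \<Longrightarrow> outputs_in p1 x (t + t' + a1) z"
    using outputs_comp by blast
  obtain p2 a2 where p2: "\<And>x t y t' z. outputs_in p1 x t y \<Longrightarrow> outputs_in p y t' z \<Longrightarrow> outputs_in p2 x (t + t' + a2) z"
    using outputs_comp by blast
  obtain p3 a3 where p3: "\<And>x t y t' z. outputs_in p2 x t y \<Longrightarrow> outputs_in pd y t' z \<Longrightarrow> outputs_in p3 x (t + t' + a3) z"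
    using outputs_comp by blast

  define X :: "nat \<Rightarrow> nat" where "X n = 200 * Suc n ^ 4" for n
  define N where "N n = length (rows k n)" for n
  define M where "M n = Suc (tree_size (enc_rank k) + X n + N n)" for n
  \<comment> \<open>The absolute value makes the bound monotone in the other factors, as
    \<open>f\<close> may take negative values.\<close>
  define T3 where "T3 n = \<bar>f (Suc k)\<bar> * real (N n) powr h (Suc k) * real (c2 * M n ^ e2) ^ d" for n
  define T where "T n = real (c3 * Suc (X n) ^ e3) + real (c1 * M n ^ e1) + T3 n + real (c4 * (2 * N n + 4) ^ e4) + real (a1 + a2 + a3)" for n

  have run: "\<exists>t. outputs_in p3 (enc_3cnf n F) t (enc_bool (satisfiable F)) \<and> real t \<le> T n"
    if F: "is_3cnf n F" for n F
  proof -
    let ?I = "reduction k n F"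
    have X: "tree_size (enc_3cnf n F) \<le> X n" using tree_size_3cnf[OF F] by (simp add: X_def)
    then have M: "Suc (m k n F) \<le> M n" by (simp add: M_def m_def N_def)
    obtain t1 where t1: "t1 \<le> c3 * Suc (tree_size (enc_3cnf n F)) ^ e3" "outputs_in pk (enc_3cnf n F) t1 (Branch (enc_rank k) (enc_3cnf n F))"
      using pk by blast
    obtain t2 where t2: "t2 \<le> c1 * Suc (m k n F) ^ e1" "outputs_in pr (Branch (enc_rank k) (enc_3cnf n F)) t2 (enc_instance ?I)"
      using pr by blast
    obtain v t3 where t3: "consistent_params ?I v" "outputs_in p (enc_instance ?I) t3 (enc_tuple v)"
       "real t3 \<le> f (rank ?I) * real (card (universe (background ?I))) powr h (rank ?I) * real (tree_size (enc_instance ?I)) ^ d"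
      using learn learnable_reduction[OF F k1] unfolding learns_in_time_def by blast
    obtain y where y: "y < N n" "v = [y]" "y = 0 \<longleftrightarrow> satisfiable F"
      using t3(1) unfolding consistent_params_reduction[OF F] N_def by blast
    obtain t4 where t4: "t4 \<le> c4 * Suc (tree_size (enc_tuple v)) ^ e4" "outputs_in pd (enc_tuple v) t4 (enc_bool (left (enc_tuple v) = Leaf))"
      using pd by blast
    have "left (enc_tuple v) = Leaf \<longleftrightarrow> satisfiable F" using y by (simp add: enc_tuple_singleton)
    then have out: "outputs_in p3 (enc_3cnf n F) (t1 + t2 + a1 + t3 + a2 + t4 + a3) (enc_bool (satisfiable F))"
      using p3[OF p2[OF p1[OF t1(2) t2(2)] t3(2)] t4(2)] by simp
    have "c3 * Suc (tree_size (enc_3cnf n F)) ^ e3 \<le> c3 * Suc (X n) ^ e3"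
      using X by (intro mult_le_mono2 power_mono) auto
    then have b1: "t1 \<le> c3 * Suc (X n) ^ e3" using t1(1) by linarith
    have "c1 * Suc (m k n F) ^ e1 \<le> c1 * M n ^ e1" using M by (intro mult_le_mono2 power_mono) auto
    then have b2: "t2 \<le> c1 * M n ^ e1" using t2(1) by linarith
    have "tree_size (enc_instance ?I) \<le> c2 * Suc (m k n F) ^ e2" by (rule size)
    also have "\<dots> \<le> c2 * M n ^ e2" using M by (intro mult_le_mono2 power_mono) auto
    finally have s: "real (tree_size (enc_instance ?I)) \<le> real (c2 * M n ^ e2)" by (simp only: of_nat_le_iff)
    have "real t3 \<le> f (Suc k) * real (N n) powr h (Suc k) * real (tree_size (enc_instance ?I)) ^ d"
      using t3(3) by (simp add: reduction_def background_def N_def)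
    also have "\<dots> \<le> T3 n" unfolding T3_def
      using s by (intro mult_mono power_mono) auto
    finally have b3: "real t3 \<le> T3 n" .
    have "c4 * Suc (tree_size (enc_tuple v)) ^ e4 \<le> c4 * (2 * N n + 4) ^ e4"
      using y by (intro mult_le_mono2 power_mono) (auto simp: enc_tuple_singleton)
    then have b4: "t4 \<le> c4 * (2 * N n + 4) ^ e4" using t4(1) by linarith
    have "real (t1 + t2 + a1 + t3 + a2 + t4 + a3) = real t1 + real t2 + real t3 + real t4 + real (a1 + a2 + a3)"
      by simp
    also have "\<dots> \<le> T n" unfolding T_def
      using b1 b2 b3 b4 by (intro add_mono) (simp_all only: of_nat_le_iff)
    finally show ?thesis using out by blast
  qed

  let ?\<kappa> = "1 / real (Suc k)"
  have zero: "exp_bounded \<gamma> u" if "exp_bounded 0 u" "0 \<le> \<gamma>" for \<gamma> u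
    using exp_bounded_mono[OF that] .
  have const: "exp_bounded \<gamma> (\<lambda>_. real c)" if "0 \<le> \<gamma>" for \<gamma> c
    using zero[OF exp_bounded_const that] by simp
  have X: "exp_bounded 0 (\<lambda>n. real (X n))"
    by (rule exp_boundedI[of _ 200 4]) (auto simp: X_def)
  have N: "exp_bounded ?\<kappa> (\<lambda>n. real (N n))" unfolding N_def by (rule exp_bounded_length_rows)
  have "exp_bounded ?\<kappa> (\<lambda>n. real 1 + (real (tree_size (enc_rank k)) + real (X n) + real (N n)))"
    by (intro exp_bounded_add N zero[OF X] const) auto
  then have M: "exp_bounded ?\<kappa> (\<lambda>n. real (M n))" by (simp add: M_def)
  have cpow: "exp_bounded (real e * \<gamma>) (\<lambda>n. real (c * u n ^ e))" if "exp_bounded \<gamma> (\<lambda>n. real (u n))" for c e \<gamma> u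
    using exp_bounded_mult[OF const[of 0 c] exp_bounded_power[OF that, of e]] by simp
  have u1: "exp_bounded (real e3 * 0) (\<lambda>n. real (c3 * Suc (X n) ^ e3))"
    by (rule cpow) (use exp_bounded_add[OF exp_bounded_const[of 1] X] in simp)
  have u2: "exp_bounded (real e1 * ?\<kappa>) (\<lambda>n. real (c1 * M n ^ e1))" by (rule cpow[OF M])
  \<comment> \<open>The three rates belong to the constant \<open>f (Suc k)\<close>, to the power of
    the universe size and to the input-length factor.\<close>
  have "exp_bounded (0 + \<epsilon> / 4 + real d * (real e2 * ?\<kappa>)) T3" unfolding T3_def
    by (intro exp_bounded_mult exp_bounded_power exp_bounded_const cpow[OF M])
      (use exp_bounded_length_rows_powr[OF hk] \<epsilon> in \<open>auto simp: N_def\<close>)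
  moreover have "exp_bounded ?\<kappa> (\<lambda>n. real (2 * N n + 4))"
    using exp_bounded_add[OF exp_bounded_add[OF N N] const[of ?\<kappa> 4]] by simp
  then have "exp_bounded (real e4 * ?\<kappa>) (\<lambda>n. real (c4 * (2 * N n + 4) ^ e4))" by (rule cpow)
  moreover have le: "real e1 * ?\<kappa> \<le> \<epsilon> / 2" "0 + \<epsilon> / 4 + real d * (real e2 * ?\<kappa>) \<le> \<epsilon> / 2" "real e4 * ?\<kappa> \<le> \<epsilon> / 2"
  proof -
    have "E * ?\<kappa> = real e1 * ?\<kappa> + real d * (real e2 * ?\<kappa>) + real e4 * ?\<kappa>"
      by (simp add: E_def add_divide_distrib)
    moreover have "0 \<le> real e1 * ?\<kappa>" "0 \<le> real d * (real e2 * ?\<kappa>)" "0 \<le> real e4 * ?\<kappa>" by auto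
    ultimately show "real e1 * ?\<kappa> \<le> \<epsilon> / 2" "0 + \<epsilon> / 4 + real d * (real e2 * ?\<kappa>) \<le> \<epsilon> / 2" "real e4 * ?\<kappa> \<le> \<epsilon> / 2"
      using Ek \<epsilon>(1) by linarith+
  qed
  ultimately have "exp_bounded (\<epsilon> / 2) T" unfolding T_def
    using \<epsilon>(1) exp_bounded_mono[OF u1, of "\<epsilon> / 2"] exp_bounded_mono[OF u2 le(1)]
    by (intro exp_bounded_add const) (auto intro: exp_bounded_mono)
  \<comment> \<open>The gap between \<open>\<epsilon> / 2\<close> and \<epsilon> absorbs all
    polynomial factors.\<close>
  then obtain K where "\<And>n. T n \<le> K * 2 powr (\<epsilon> * real n)"
    using exp_bounded_imp[of "\<epsilon> / 2" T \<epsilon>] \<epsilon>(1) by auto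
  then have "solves_3sat_in_exp p3 \<epsilon>"
    unfolding solves_3sat_in_exp_def using run by (meson order_trans)
  then show False using \<epsilon>(2) by blast
qed

end
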